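(* Let $k\ge 2$ and $t_1,\dots,t_k\in\mathbb N$, and set $H:=P(t_1,\dots,t_k)$. For every $\eta>0$ there exists $n_0=n_0(\eta,H)\in\mathbb N$ such that for all $n\ge n_0$, every $n$-vertex digraph $G$ with $\delta(G)\ge(1+\eta)n$ contains an $H$-tiling covering all but at most $\eta n$ vertices of $G$.
   Context: Digraphs have no loops and at most one edge in each direction between any pair of vertices. $P(t_1,\dots,t_k)$ is the blow-up of the directed path $v_1\dots v_k$ (edges $v_iv_{i+1}$) in which each $v_i$ is replaced by a set $A_i$ of $t_i$ vertices, with the edge $ab$ present for all $a\in A_i$, $b\in A_{i+1}$, $i\in[k-1]$, and no other edges. $\delta(G)$ is the minimum over vertices of in-degree plus out-degree. An $H$-tiling is a collection of vertex-disjoint copies of $H$. *)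

theory Defs
  imports Complex_Main "Graph_Theory.Graph_Theory"
begin

text \<open>
  Digraphs are those of the locale \<open>pair_digraph\<close>: finite, loopless, and with arcs given
  as ordered pairs, so both \<open>(u, v)\<close> and \<open>(v, u)\<close> may be present, each at most once.
\<close>

text \<open>
  The blow-up \<open>P(t\<^sub>1, \<dots>, t\<^sub>k)\<close> of the directed path on \<open>k\<close> vertices: the part \<open>A\<^sub>i\<close>
  is \<open>{i} \<times> {1..t i}\<close>.
\<close>

definition path_blowup :: "nat \<Rightarrow> (nat \<Rightarrow> nat) \<Rightarrow> (nat \<times> nat) pair_pre_digraph" where
  "path_blowup k t =
    \<lparr> pverts = (SIGMA i:{1..k}. {1..t i}),
      parcs = {((i, a), (Suc i, b)) | i a b.
                 i \<in> {1..k - 1} \<and> a \<in> {1..t i} \<and> b \<in> {1..t (Suc i)}} \<rparr>"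

lemma pair_digraph_path_blowup: "pair_digraph (path_blowup k t)"
proof
  have sub: "parcs (path_blowup k t) \<subseteq> pverts (path_blowup k t) \<times> pverts (path_blowup k t)"
    by (auto simp: path_blowup_def)
  show fin: "finite (pverts (path_blowup k t))"
    by (simp add: path_blowup_def)
  show "finite (parcs (path_blowup k t))"
    by (rule finite_subset[OF sub]) (simp add: fin)
  fix e assume "e \<in> parcs (path_blowup k t)"
  then show "fst e \<in> pverts (path_blowup k t)" "snd e \<in> pverts (path_blowup k t)"
      "fst e \<noteq> snd e"
    using sub by (auto simp: path_blowup_def)
qed

text \<open>The value is unspecified if \<open>G\<close> has no vertices.\<close>

definition min_total_degree :: "'a pair_pre_digraph \<Rightarrow> nat" where
  "min_total_degree G =
    Min ((\<lambda>v. in_degree (with_proj G) v + out_degree (with_proj G) v) ` pverts G)"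

text \<open>A copy is a subgraph, not necessarily induced.\<close>

definition copy_of :: "'h pair_pre_digraph \<Rightarrow> 'a pair_pre_digraph \<Rightarrow> 'a pair_pre_digraph \<Rightarrow> bool"
  where
  "copy_of H G C \<longleftrightarrow>
    subgraph (with_proj C) (with_proj G) \<and> digraph_iso (with_proj H) (with_proj C)"

definition tiling ::
    "'h pair_pre_digraph \<Rightarrow> 'a pair_pre_digraph \<Rightarrow> 'a pair_pre_digraph set \<Rightarrow> bool" where
  "tiling H G \<T> \<longleftrightarrow>
    (\<forall>C\<in>\<T>. copy_of H G C) \<and>
    (\<forall>C\<in>\<T>. \<forall>D\<in>\<T>. C \<noteq> D \<longrightarrow> pverts C \<inter> pverts D = {})"

end

theory Submission
  imports Defs "HOL-Library.FuncSet" "HOL-Library.Disjoint_Sets"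
begin

text \<open>
  Total degree at least \<open>|W|\<close> on a vertex set \<open>W\<close> forces a 1-factor (a permutation moving each
  vertex along an arc): if \<open>N(S)\<close>, the out-neighbourhood of \<open>S\<close>, were smaller than \<open>S\<close>, a vertex
  of \<open>S - N(S)\<close> would have too few neighbours. The blow-up of a 1-factor in which each vertex
  becomes \<open>h = |H|\<close> vertices has a perfect \<open>H\<close>-tiling.

  Take a largest \<open>H\<close>-tiling, suppose that more than \<open>\<eta>n\<close> vertices are left, and chop these into
  further blocks of size \<open>h\<close>. A constant number \<open>s\<close> of random blocks, tiles or chopped ones,
  inherits the degree condition at all but few of its vertices, and contains a proportional number
  of chopped blocks. By pigeonhole and Erdos's theorem on dense \<open>s\<close>-partite hypergraphs, some such
  sample occurs \<open>h\<close>-fold blown up in \<open>G\<close>, on \<open>sh\<close> distinct blocks. Retiling this blow-up along a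
  1-factor of the sample yields more tiles than were destroyed, a contradiction.
\<close>

section \<open>Hall's theorem and 1-factors\<close>

text \<open>Induction on \<open>I\<close>. A tight nonempty proper subset, one with exactly as many
  candidates as members, can be matched separately from its complement; if there is none, every
  nonempty proper subset has a spare candidate and one index may be matched arbitrarily.\<close>

lemma hall:
  fixes A :: "'b \<Rightarrow> 'c set"
  assumes "finite I" and "\<And>i. i \<in> I \<Longrightarrow> finite (A i)"
    and "\<And>J. J \<subseteq> I \<Longrightarrow> card J \<le> card (\<Union>(A ` J))"
  shows "\<exists>f. inj_on f I \<and> (\<forall>i\<in>I. f i \<in> A i)"
  using assms
proof (induction I arbitrary: A rule: finite_psubset_induct)
  case (psubset I)
  note fin = psubset.prems(1) and cond = psubset.prems(2)
  have finU: "finite (\<Union>(A ` J))" if "J \<subseteq> I" for J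
    using that fin psubset.hyps by (auto intro: finite_subset)
  show ?case
  proof (cases "I = {}")
    case False
    then obtain i where i: "i \<in> I" by auto
    show ?thesis
    proof (cases "\<exists>J. J \<subset> I \<and> J \<noteq> {} \<and> card J = card (\<Union>(A ` J))")
      case True
      then obtain J where J: "J \<subset> I" "J \<noteq> {}" "card J = card (\<Union>(A ` J))" by auto
      let ?N = "\<Union>(A ` J)"
      have "\<exists>f. inj_on f J \<and> (\<forall>i\<in>J. f i \<in> A i)"
      proof (rule psubset.IH[OF J(1)])
        show "finite (A i)" if "i \<in> J" for i using fin that J(1) by auto
        show "card K \<le> card (\<Union>(A ` K))" if "K \<subseteq> J" for K by (rule cond) (use that J(1) in auto)
      qed
      then obtain f where f: "inj_on f J" "\<forall>i\<in>J. f i \<in> A i" by auto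
      have sub: "I - J \<subset> I" using J by auto
      \<comment> \<open>Hall's condition for \<open>K \<union> J\<close>, minus the equality for the
        tight set \<open>J\<close>.\<close>
      have "card K \<le> card (\<Union>((\<lambda>j. A j - ?N) ` K))" if K: "K \<subseteq> I - J" for K
      proof -
        have fK: "finite K" "finite J" using K J psubset.hyps by (auto intro: finite_subset)
        have "card K + card J = card (K \<union> J)"
          using K fK by (subst card_Un_disjoint) auto
        also have "\<dots> \<le> card (\<Union>(A ` (K \<union> J)))" by (rule cond) (use K J in auto)
        also have "\<Union>(A ` (K \<union> J)) = \<Union>((\<lambda>j. A j - ?N) ` K) \<union> ?N" by auto
        also have "card \<dots> \<le> card (\<Union>((\<lambda>j. A j - ?N) ` K)) + card ?N" by (rule card_Un_le)
        finally show ?thesis using J(3) by simp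
      qed
      then have "\<exists>g. inj_on g (I - J) \<and> (\<forall>i\<in>I-J. g i \<in> A i - ?N)"
        by (intro psubset.IH[OF sub]) (use fin in auto)
      then obtain g where g: "inj_on g (I - J)" "\<forall>i\<in>I-J. g i \<in> A i - ?N" by auto
      let ?h = "\<lambda>i. if i \<in> J then f i else g i"
      have "f ` J \<inter> g ` (I - J) = {}" using f(2) g(2) by fastforce
      then have "inj_on ?h (J \<union> (I - J))"
        by (rule inj_on_disjoint_Un[OF f(1) g(1)])
      then have "inj_on ?h I" using J(1) by (simp add: Un_absorb1 psubset_imp_subset)
      moreover have "\<forall>i\<in>I. ?h i \<in> A i" using f g by auto
      ultimately show ?thesis by blast
    next
      case no: False
      have "card {i} \<le> card (\<Union>(A ` {i}))" by (rule cond) (use i in auto)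
      then obtain x where x: "x \<in> A i" by fastforce
      have sub: "I - {i} \<subset> I" using i by auto
      \<comment> \<open>A nonempty \<open>K\<close> omits \<open>i\<close>, so it is proper and not
        tight; the strict inequality pays for the loss of \<open>x\<close>.\<close>
      have "card K \<le> card (\<Union>((\<lambda>j. A j - {x}) ` K))" if K: "K \<subseteq> I - {i}" for K
      proof (cases "K = {}")
        case False
        have "card K \<le> card (\<Union>(A ` K))" by (rule cond) (use K in auto)
        moreover have "card K \<noteq> card (\<Union>(A ` K))" using no False K i by blast
        moreover have "\<Union>((\<lambda>j. A j - {x}) ` K) = \<Union>(A ` K) - {x}" by auto
        moreover have "card (\<Union>(A ` K)) - 1 \<le> card (\<Union>(A ` K) - {x})"
          by (simp add: card_Diff_singleton_if)
        ultimately show ?thesis by simp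
      qed simp
      then have "\<exists>g. inj_on g (I - {i}) \<and> (\<forall>j\<in>I-{i}. g j \<in> A j - {x})"
        by (intro psubset.IH[OF sub]) (use fin in auto)
      then obtain g where g: "inj_on g (I - {i})" "\<forall>j\<in>I-{i}. g j \<in> A j - {x}" by auto
      have "inj_on (g(i := x)) I"
        using g unfolding inj_on_def by auto
      moreover have "\<forall>j\<in>I. (g(i := x)) j \<in> A j" using g x by auto
      ultimately show ?thesis by blast
    qed
  qed simp
qed

text \<open>Total degree inside \<open>V\<close> for an arbitrary relation, so that one notion
  serves for \<open>G\<close>, for its pullback to blocks, and for samples of blocks.\<close>

definition deg_in :: "('v \<Rightarrow> 'v \<Rightarrow> bool) \<Rightarrow> 'v set \<Rightarrow> 'v \<Rightarrow> nat" where
  "deg_in E V v = card {u \<in> V. E v u} + card {u \<in> V. E u v}"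

lemma one_factor_exists:
  assumes fin: "finite W" and deg: "\<And>w. w \<in> W \<Longrightarrow> card W \<le> deg_in F W w"
  shows "\<exists>\<sigma>. bij_betw \<sigma> W W \<and> (\<forall>w\<in>W. F w (\<sigma> w))"
proof -
  let ?A = "\<lambda>w. {u \<in> W. F w u}"
  have "card J \<le> card (\<Union>(?A ` J))" if J: "J \<subseteq> W" for J
  proof (rule ccontr)
    assume less: "\<not> ?thesis"
    let ?N = "\<Union>(?A ` J)"
    have N: "?N \<subseteq> W" by auto
    have finN: "finite ?N" "finite J" using N J fin by (auto intro: finite_subset)
    have "\<not> J \<subseteq> ?N" using less card_mono[OF finN(1)] by auto
    then obtain v where v: "v \<in> J" "v \<notin> ?N" by auto
    \<comment> \<open>Out-neighbours of \<open>v\<close> lie in \<open>?N\<close>. In-neighbours lie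
      outside \<open>J\<close>, since \<open>v\<close> is not in \<open>?N\<close> and so receives
      no arc from \<open>J\<close>.\<close>
    have "card {u \<in> W. F v u} \<le> card ?N" using v finN by (intro card_mono) auto
    moreover have "card {u \<in> W. F u v} \<le> card (W - J)"
      using v J fin by (intro card_mono) auto
    moreover have "card (W - J) = card W - card J" "card J \<le> card W"
      using J fin finN by (auto simp: card_Diff_subset card_mono)
    ultimately have "deg_in F W v < card W" using less unfolding deg_in_def by linarith
    then show False using deg[of v] v J by auto
  qed
  then obtain \<sigma> where \<sigma>: "inj_on \<sigma> W" "\<forall>w\<in>W. \<sigma> w \<in> ?A w"
    using hall[OF fin, of ?A] fin by auto
  then have "\<sigma> ` W \<subseteq> W" by auto
  then have "bij_betw \<sigma> W W" using \<sigma>(1) fin by (simp add: bij_betw_def endo_inj_surj)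
  then show ?thesis using \<sigma> by auto
qed

section \<open>Degrees inside subsets and over blocks\<close>

text \<open>A removed vertex may be both an in-neighbour and an out-neighbour, hence the factor
  2.\<close>

lemma deg_in_le_Diff:
  assumes "finite V" "V' \<subseteq> V"
  shows "deg_in E V v \<le> deg_in E V' v + 2 * card (V - V')"
proof -
  have "card {u \<in> V. P u} \<le> card {u \<in> V'. P u} + card (V - V')" for P
  proof -
    have "card {u \<in> V. P u} \<le> card ({u \<in> V'. P u} \<union> (V - V'))"
      using assms by (intro card_mono) (auto intro: finite_subset)
    also have "\<dots> \<le> card {u \<in> V'. P u} + card (V - V')" by (rule card_Un_le)
    finally show ?thesis .
  qed
  from this[of "E v"] this[of "\<lambda>u. E u v"] show ?thesis unfolding deg_in_def by linarith
qed

lemma deg_in_bij_betw: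
  assumes bij: "bij_betw \<phi> A B"
  shows "deg_in (\<lambda>u v. E (\<phi> u) (\<phi> v)) A v = deg_in E B (\<phi> v)"
proof -
  have "card {u \<in> A. P (\<phi> u)} = card {u \<in> B. P u}" for P
    by (rule bij_betw_same_card[of \<phi>]) (use bij in \<open>auto simp: bij_betw_def inj_on_def\<close>)
  then show ?thesis unfolding deg_in_def by simp
qed

lemma deg_in_singleton_Times:
  "deg_in E ({y} \<times> H) v = card {b \<in> H. E v (y, b)} + card {b \<in> H. E (y, b) v}"
proof -
  have "{u \<in> {y} \<times> H. P u} = Pair y ` {b \<in> H. P (y, b)}" for P by auto
  then show ?thesis unfolding deg_in_def by (simp add: card_image inj_on_def)
qed

lemma deg_in_Times:
  assumes "finite Y" "finite H"
  shows "deg_in E (Y \<times> H) v = (\<Sum>y\<in>Y. deg_in E ({y} \<times> H) v)"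
  using assms(1)
proof (induction Y rule: finite_induct)
  case (insert y Y)
  have "card {u \<in> insert y Y \<times> H. P u} = card {u \<in> {y} \<times> H. P u} + card {u \<in> Y \<times> H. P u}" for P
  proof -
    have "{u \<in> insert y Y \<times> H. P u} = {u \<in> {y} \<times> H. P u} \<union> {u \<in> Y \<times> H. P u}" by auto
    then show ?thesis
      using insert.hyps assms(2) by (simp add: card_Un_disjoint disjoint_iff)
  qed
  then have "deg_in E (insert y Y \<times> H) v = deg_in E ({y} \<times> H) v + deg_in E (Y \<times> H) v"
    unfolding deg_in_def by simp
  then show ?case using insert by simp
qed (simp add: deg_in_def)

section \<open>Counting in function spaces: pigeonhole and second moments\<close>

text \<open>Splits off one sampled coordinate; used for inductions on the number of coordinates and
  for conditioning on a single block.\<close>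

lemma sum_PiE_insert:
  assumes "i \<notin> S"
  shows "(\<Sum>f\<in>PiE (insert i S) (\<lambda>_. X). G f) = (\<Sum>z\<in>X. \<Sum>f\<in>PiE S (\<lambda>_. X). G (f(i := z)))"
proof -
  have "(\<Sum>f\<in>PiE (insert i S) (\<lambda>_. X). G f)
      = (\<Sum>p\<in>X \<times> PiE S (\<lambda>_. X). G ((\<lambda>(y, g). g(i := y)) p))"
    unfolding PiE_insert_eq using inj_combinator[OF assms, of "\<lambda>_. X"]
    by (subst sum.reindex) (auto simp: o_def)
  then show ?thesis by (simp add: sum.cartesian_product split_beta)
qed

lemma real_card_eq_sum: "finite A \<Longrightarrow> real (card {x \<in> A. P x}) = (\<Sum>x\<in>A. of_bool (P x))"
  by (simp add: Int_def)

text \<open>Some class is at least of average size. An element may belong to several classes, which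
  only enlarges the sum of the class sizes.\<close>

lemma pigeonhole_card:
  assumes "finite A" "finite C" "A \<noteq> {}" and cover: "\<And>a. a \<in> A \<Longrightarrow> \<exists>c\<in>C. R a c"
  shows "\<exists>c\<in>C. card A \<le> card C * card {a \<in> A. R a c}"
proof (rule ccontr)
  assume "\<not> ?thesis"
  then have less: "card C * card {a \<in> A. R a c} < card A" if "c \<in> C" for c using that by auto
  have C: "C \<noteq> {}" using assms(3) cover by auto
  have "card A \<le> card (\<Union>c\<in>C. {a \<in> A. R a c})"
    using assms by (intro card_mono) auto
  also have "\<dots> \<le> (\<Sum>c\<in>C. card {a \<in> A. R a c})" by (rule card_UN_le[OF assms(2)])
  finally have "card C * card A \<le> (\<Sum>c\<in>C. card C * card {a \<in> A. R a c})"
    by (simp add: sum_distrib_left[symmetric])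
  also have "\<dots> < (\<Sum>c\<in>C. card A)" using less C assms(2) by (intro sum_strict_mono) auto
  finally show False by simp
qed

text \<open>The variance of a sum of independent centred variables is the sum of their variances;
  both sides are multiplied by \<open>card X ^ (card S + 1)\<close> to clear the denominators of the
  averages.\<close>

lemma sum_square_PiE:
  fixes g :: "'b \<Rightarrow> real"
  assumes "finite S" "finite X" and zero: "(\<Sum>x\<in>X. g x) = 0"
  shows "real (card X) * (\<Sum>f\<in>PiE S (\<lambda>_. X). (\<Sum>i\<in>S. g (f i))\<^sup>2)
    = real (card S) * real (card X) ^ card S * (\<Sum>x\<in>X. (g x)\<^sup>2)"
  using assms(1)
proof (induction S rule: finite_induct)
  case (insert i S)
  let ?N = "PiE S (\<lambda>_. X)"
  let ?G = "\<lambda>f. \<Sum>j\<in>S. g (f j)"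
  let ?r = "real (card X)" and ?q = "\<Sum>x\<in>X. (g x)\<^sup>2"
  have eq: "(\<Sum>j\<in>insert i S. g ((f(i := z)) j)) = g z + ?G f" for f z
  proof -
    have "(\<Sum>j\<in>S. g ((f(i := z)) j)) = ?G f"
      using insert.hyps by (intro sum.cong) auto
    then show ?thesis using insert.hyps by simp
  qed
  have cardN: "real (card ?N) = ?r ^ card S"
    using insert.hyps by (simp add: card_PiE)
  have "(\<Sum>f\<in>PiE (insert i S) (\<lambda>_. X). (\<Sum>j\<in>insert i S. g (f j))\<^sup>2)
      = (\<Sum>z\<in>X. \<Sum>f\<in>?N. (g z + ?G f)\<^sup>2)"
    by (simp only: sum_PiE_insert[OF insert.hyps(2)] eq)
  also have "\<dots> = (\<Sum>z\<in>X. ?r ^ card S * (g z)\<^sup>2 + g z * (2 * (\<Sum>f\<in>?N. ?G f)) + (\<Sum>f\<in>?N. (?G f)\<^sup>2))"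
    by (simp add: power2_sum sum.distrib sum_distrib_left cardN algebra_simps)
  \<comment> \<open>The mixed terms cancel, as \<open>g\<close> sums to 0 over
    \<open>X\<close>.\<close>
  also have "\<dots> = ?r ^ card S * ?q + ?r * (\<Sum>f\<in>?N. (?G f)\<^sup>2)"
    by (simp add: sum.distrib zero flip: sum_distrib_left sum_distrib_right)
  finally show ?case using insert by (simp add: algebra_simps)
qed simp

text \<open>Chebyshev's inequality for the sum of independent uniform samples from \<^term>\<open>X\<close>.\<close>

lemma card_low_sum_le:
  fixes g :: "'b \<Rightarrow> real" and K \<mu> \<tau> :: real
  assumes "finite S" "finite X" "X \<noteq> {}"
    and g: "\<And>x. x \<in> X \<Longrightarrow> 0 \<le> g x \<and> g x \<le> K"
    and mean: "\<mu> * card X \<le> (\<Sum>x\<in>X. g x)" and \<tau>: "\<tau> \<le> \<mu> * card S"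
  shows "real (card {f \<in> PiE S (\<lambda>_. X). (\<Sum>i\<in>S. g (f i)) < \<tau>}) * (\<mu> * card S - \<tau>)\<^sup>2
    \<le> card S * K\<^sup>2 * real (card X) ^ card S"
proof -
  let ?N = "PiE S (\<lambda>_. X)"
  let ?r = "real (card X)"
  \<comment> \<open>The true mean, of which \<open>\<mu>\<close> is only a lower bound; subtracting
    it makes \<open>sum_square_PiE\<close> applicable.\<close>
  define m where "m = (\<Sum>x\<in>X. g x) / ?r"
  have r: "?r > 0" using assms by (simp add: card_gt_0_iff)
  have mge: "\<mu> \<le> m" using mean r by (simp add: m_def field_simps)
  have "(\<Sum>x\<in>X. g x) \<le> (\<Sum>x\<in>X. K)" "0 \<le> (\<Sum>x\<in>X. g x)"
    using g by (meson sum_mono sum_nonneg)+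
  then have m: "0 \<le> m" "m \<le> K" using r by (auto simp: m_def field_simps)
  let ?g = "\<lambda>x. g x - m"
  have sq: "(?g x)\<^sup>2 \<le> K\<^sup>2" if "x \<in> X" for x
    using g[OF that] m by (intro abs_le_square_iff[THEN iffD1]) auto
  have zero: "(\<Sum>x\<in>X. ?g x) = 0" using r by (simp add: sum_subtractf m_def)
  have finN: "finite ?N" using assms by (simp add: finite_PiE)
  let ?L = "{f \<in> ?N. (\<Sum>i\<in>S. g (f i)) < \<tau>}"
  \<comment> \<open>On \<open>?L\<close> the sum is below \<open>\<tau>\<close>, hence more than
    \<open>\<mu> * card S - \<tau>\<close> below its mean \<open>m * card S\<close>.\<close>
  have "real (card ?L) * (\<mu> * card S - \<tau>)\<^sup>2 = (\<Sum>f\<in>?L. (\<mu> * card S - \<tau>)\<^sup>2)" by simp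
  also have "\<dots> \<le> (\<Sum>f\<in>?L. (\<Sum>i\<in>S. ?g (f i))\<^sup>2)"
  proof (rule sum_mono)
    fix f assume "f \<in> ?L"
    moreover have "\<mu> * card S \<le> m * card S" using mge by (simp add: mult_right_mono)
    ultimately show "(\<mu> * card S - \<tau>)\<^sup>2 \<le> (\<Sum>i\<in>S. ?g (f i))\<^sup>2"
      using \<tau> by (intro abs_le_square_iff[THEN iffD1]) (simp add: sum_subtractf mult.commute)
  qed
  also have "\<dots> \<le> (\<Sum>f\<in>?N. (\<Sum>i\<in>S. ?g (f i))\<^sup>2)"
    by (rule sum_mono2) (auto simp: finN)
  finally have "?r * (real (card ?L) * (\<mu> * card S - \<tau>)\<^sup>2)
      \<le> ?r * (\<Sum>f\<in>?N. (\<Sum>i\<in>S. ?g (f i))\<^sup>2)"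
    using r by (intro mult_left_mono) auto
  also have "\<dots> = real (card S) * ?r ^ card S * (\<Sum>x\<in>X. (?g x)\<^sup>2)"
    by (rule sum_square_PiE[OF assms(1,2) zero])
  also have "\<dots> \<le> real (card S) * ?r ^ card S * (\<Sum>x\<in>X. K\<^sup>2)"
    using sq by (intro mult_left_mono sum_mono) auto
  also have "\<dots> = ?r * (card S * K\<^sup>2 * ?r ^ card S)" by simp
  finally show ?thesis using r by simp
qed

section \<open>Boxes in dense hypergraphs\<close>

text \<open>Erdos's theorem on dense \<open>s\<close>-partite hypergraphs; \<^term>\<open>P\<close> is the edge set.\<close>

lemma dense_contains_box:
  fixes b s :: nat
  shows "\<forall>c>0::real. \<exists>r0. \<forall>(X::'b set) P. finite X \<and> card X \<ge> r0 \<and>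
     c * real (card X) ^ s \<le> real (card {f\<in>PiE {..<s} (\<lambda>_. X). P f}) \<longrightarrow>
     (\<exists>B. (\<forall>i<s. B i \<subseteq> X \<and> card (B i) = b) \<and> (\<forall>f\<in>PiE {..<s} B. P f))"
proof (induction s)
  \<comment> \<open>Over no coordinates there is a single function, and positive density says that
    it satisfies \<open>P\<close>.\<close>
  case 0
  have "P f" if "c > 0" "c \<le> real (card {g. g = (\<lambda>_. undefined) \<and> P g})" "f = (\<lambda>_. undefined)"
    for c :: real and P and f :: "nat \<Rightarrow> 'b"
  proof (rule ccontr)
    assume "\<not> P f"
    then have "{g. g = (\<lambda>_. undefined) \<and> P g} = {}" using that(3) by blast
    then have "card {g. g = (\<lambda>_. undefined) \<and> P g} = 0" by (simp only: card.empty)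
    then show False using that(1,2) by linarith
  qed
  then show ?case by auto
next
  case (Suc s)
  show ?case
  proof (intro allI impI)
    fix c :: real assume c: "c > 0"
    \<comment> \<open>The number of values of the last coordinate that will be kept. As
      \<open>b \<le> M * c / 4\<close>, functions with fewer than \<open>b\<close> admissible values
      among them account for at most half of the density.\<close>
    define M where "M = nat \<lceil>4 * real b / c\<rceil> + 1"
    have M: "M > 0" "real M \<ge> 4 * real b / c" unfolding M_def by linarith+
    \<comment> \<open>A proportion \<open>c / 4\<close> of the functions on the first
      \<open>s\<close> coordinates will be good; the factor \<open>2 ^ M\<close> pays for the
      pigeonhole over subsets of the kept values.\<close>
    define c' where "c' = c / 4 / 2 ^ M"
    have "c' > 0" using c by (simp add: c'_def)
    then obtain r1 where r1: "\<And>(X::'b set) P. \<lbrakk>finite X; card X \<ge> r1;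
        c' * real (card X) ^ s \<le> real (card {f\<in>PiE {..<s} (\<lambda>_. X). P f})\<rbrakk> \<Longrightarrow>
        \<exists>B. (\<forall>i<s. B i \<subseteq> X \<and> card (B i) = b) \<and> (\<forall>f\<in>PiE {..<s} B. P f)"
      using Suc by meson
    \<comment> \<open>The second summand ensures that \<open>Z0\<close> below has at least
      \<open>M\<close> members.\<close>
    define r0 where "r0 = r1 + nat \<lceil>2 * real M / c\<rceil> + 1"
    show "\<exists>r0. \<forall>(X::'b set) P. finite X \<and> card X \<ge> r0 \<and>
     c * real (card X) ^ Suc s \<le> real (card {f\<in>PiE {..<Suc s} (\<lambda>_. X). P f}) \<longrightarrow>
     (\<exists>B. (\<forall>i<Suc s. B i \<subseteq> X \<and> card (B i) = b) \<and> (\<forall>f\<in>PiE {..<Suc s} B. P f))"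
    proof (intro exI[of _ r0] allI impI, elim conjE)
      fix X :: "'b set" and P
      assume fin: "finite X" and big: "card X \<ge> r0"
        and dense: "c * real (card X) ^ Suc s \<le> real (card {f\<in>PiE {..<Suc s} (\<lambda>_. X). P f})"
      let ?r = "real (card X)" and ?N = "PiE {..<s} (\<lambda>_. X)"
      have r: "?r > 0" "?r \<ge> 2 * real M / c" "card X \<ge> r1" using big unfolding r0_def by linarith+
      have finN: "finite ?N" using fin by (simp add: finite_PiE)
      have cardN: "real (card ?N) = ?r ^ s" by (simp add: card_PiE)
      define g where "g z = real (card {f \<in> ?N. P (f(s := z))})" for z
      have gle: "g z \<le> ?r ^ s" for z
        unfolding g_def cardN[symmetric] using finN by (auto intro: card_mono)
      \<comment> \<open>Values whose link has density at least \<open>c / 2\<close>. All other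
        values together contribute at most half of the required edges, so \<open>Z0\<close> has at
        least \<open>c / 2 * card X\<close> members.\<close>
      define Z0 where "Z0 = {z \<in> X. g z \<ge> c / 2 * ?r ^ s}"
      have "real (card {f\<in>PiE {..<Suc s} (\<lambda>_. X). P f}) = (\<Sum>z\<in>X. g z)"
        using fin by (simp add: real_card_eq_sum finite_PiE g_def finN lessThan_Suc sum_PiE_insert
            del: sum_of_bool_eq)
      then have "c * ?r ^ Suc s \<le> (\<Sum>z\<in>X. g z)" using dense by simp
      also have "\<dots> \<le> (\<Sum>z\<in>X. ?r ^ s * of_bool (z \<in> Z0) + c / 2 * ?r ^ s)"
        using gle c by (intro sum_mono) (auto simp: Z0_def intro: add_increasing2)
      also have "\<dots> = ?r ^ s * card Z0 + ?r * (c / 2 * ?r ^ s)"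
      proof -
        have "{z \<in> X. z \<in> Z0} = Z0" by (auto simp: Z0_def)
        then have "(\<Sum>z\<in>X. of_bool (z \<in> Z0)) = real (card Z0)"
          using real_card_eq_sum[OF fin, of "\<lambda>z. z \<in> Z0"] by simp
        then show ?thesis by (simp only: sum.distrib sum_distrib_left[symmetric] sum_constant) simp
      qed
      finally have "?r ^ s * (c / 2 * ?r) \<le> ?r ^ s * card Z0" by (simp add: algebra_simps)
      then have "c / 2 * ?r \<le> card Z0" using r(1) by simp
      moreover have "real M \<le> c / 2 * ?r" using r(2) c by (simp add: field_simps)
      ultimately have "M \<le> card Z0" by simp
      then obtain Z where Z: "Z \<subseteq> Z0" "card Z = M" "finite Z"
        using obtain_subset_with_card_n by metis
      define S where "S f = {z \<in> Z. P (f(s := z))}" for f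
      have SZ: "card (S f) \<le> M" for f
        unfolding S_def Z(2)[symmetric] by (rule card_mono) (use Z in auto)
      define Good where "Good = {f \<in> ?N. b \<le> card (S f)}"
      have finG: "finite Good" using finN by (simp add: Good_def)
      \<comment> \<open>Double counting of pairs of a function and an admissible value in
        \<open>Z\<close>: a good function accounts for at most \<open>M\<close> pairs, any other for
        fewer than \<open>b\<close>.\<close>
      have "real M * (c / 2 * ?r ^ s) = (\<Sum>z\<in>Z. c / 2 * ?r ^ s)" by (simp add: Z)
      also have "\<dots> \<le> (\<Sum>z\<in>Z. g z)" using Z by (intro sum_mono) (auto simp: Z0_def)
      also have "\<dots> = (\<Sum>f\<in>?N. real (card (S f)))"
        unfolding g_def S_def using Z finN
        by (simp add: real_card_eq_sum del: sum_of_bool_eq) (rule sum.swap)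
      also have "\<dots> \<le> (\<Sum>f\<in>?N. real M * of_bool (f \<in> Good) + real b)"
        using SZ by (intro sum_mono) (auto simp: Good_def intro: add_increasing2)
      also have "\<dots> = real M * card Good + ?r ^ s * b"
      proof -
        have "{f \<in> ?N. f \<in> Good} = Good" by (auto simp: Good_def)
        then have "(\<Sum>f\<in>?N. of_bool (f \<in> Good)) = real (card Good)"
          using real_card_eq_sum[OF finN, of "\<lambda>z. z \<in> Good"] by simp
        then show ?thesis by (simp only: sum.distrib sum_distrib_left[symmetric] sum_constant cardN)
      qed
      also have "?r ^ s * b \<le> ?r ^ s * (real M * c / 4)"
        using M c by (intro mult_left_mono) (auto simp: field_simps)
      finally have "real M * (c / 4 * ?r ^ s) \<le> real M * card Good" by (simp add: algebra_simps)
      then have Good: "c / 4 * ?r ^ s \<le> card Good" using M by simp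
      \<comment> \<open>Every good function admits some \<open>b\<close>-subset of \<open>Z\<close>.
        A popular one, \<open>B0\<close>, becomes the last side of the box, and the induction
        hypothesis supplies the other sides.\<close>
      define Q where "Q = {B. B \<subseteq> Z \<and> card B = b}"
      have finQ: "finite Q" using Z by (simp add: Q_def)
      have "card Q \<le> card (Pow Z)" using Z by (intro card_mono) (auto simp: Q_def)
      then have cardQ: "real (card Q) \<le> 2 ^ M"
        using Z by (simp add: card_Pow)
      have "real (card Good) > 0" using Good c r(1) by (smt (verit) zero_less_power mult_pos_pos divide_pos_pos)
      then have "Good \<noteq> {}" by auto
      moreover have "\<exists>B\<in>Q. B \<subseteq> S f" if f: "f \<in> Good" for f
      proof -
        have "b \<le> card (S f)" using f by (simp add: Good_def)
        then obtain B where "B \<subseteq> S f" "card B = b" using obtain_subset_with_card_n by metis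
        then show ?thesis unfolding Q_def S_def by blast
      qed
      ultimately obtain B0 where B0: "B0 \<in> Q"
          "card Good \<le> card Q * card {f \<in> Good. B0 \<subseteq> S f}"
        using pigeonhole_card[OF finG finQ, of "\<lambda>f B. B \<subseteq> S f"] by blast
      have sub: "{f \<in> Good. B0 \<subseteq> S f} \<subseteq> {f \<in> ?N. \<forall>z\<in>B0. P (f(s := z))}"
        by (auto simp: Good_def S_def)
      have "c / 4 * ?r ^ s \<le> real (card Q) * card {f \<in> Good. B0 \<subseteq> S f}"
        using Good B0(2) by (smt (verit) of_nat_le_iff of_nat_mult)
      also have "\<dots> \<le> 2 ^ M * real (card {f \<in> ?N. \<forall>z\<in>B0. P (f(s := z))})"
        using cardQ finN sub by (intro mult_mono) (auto intro!: card_mono)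
      finally have "c' * ?r ^ s \<le> card {f \<in> ?N. \<forall>z\<in>B0. P (f(s := z))}"
        by (simp add: c'_def field_simps)
      then obtain B where B: "\<forall>i<s. B i \<subseteq> X \<and> card (B i) = b"
          "\<forall>f\<in>PiE {..<s} B. \<forall>z\<in>B0. P (f(s := z))"
        using r1[OF fin r(3), of "\<lambda>f. \<forall>z\<in>B0. P (f(s := z))"] by blast
      have "\<forall>i<Suc s. (B(s := B0)) i \<subseteq> X \<and> card ((B(s := B0)) i) = b"
        using B(1) B0(1) Z(1) by (auto simp: Q_def Z0_def less_Suc_eq)
      moreover have "P f" if f: "f \<in> PiE {..<Suc s} (B(s := B0))" for f
      proof -
        have "f i \<in> B i" if "i < s" for i
          using PiE_mem[OF f, of i] that by simp
        then have "restrict f {..<s} \<in> PiE {..<s} B" by (simp add: restrict_PiE_iff)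
        moreover have "f s \<in> B0" using PiE_mem[OF f, of s] by simp
        ultimately have "P ((restrict f {..<s})(s := f s))" using B(2) by blast
        \<comment> \<open>Restriction forgets the value at \<open>s\<close>, which is then restored;
          beyond \<open>s\<close> both functions are \<open>undefined\<close>.\<close>
        moreover have "(restrict f {..<s})(s := f s) = f"
        proof
          fix i show "((restrict f {..<s})(s := f s)) i = f i"
            using PiE_arb[OF f, of i] by auto
        qed
        ultimately show ?thesis by simp
      qed
      ultimately show "\<exists>B. (\<forall>i<Suc s. B i \<subseteq> X \<and> card (B i) = b) \<and> (\<forall>f\<in>PiE {..<Suc s} B. P f)"
        by blast
    qed
  qed
qed

text \<open>Hall's theorem with \<open>h\<close> demands per index: any single \<open>B i\<close>
  already has room for all \<open>card I * h\<close> demands.\<close>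

lemma disjoint_subsets_exist:
  fixes B :: "'i \<Rightarrow> 'b set"
  assumes "finite I" and B: "\<And>i. i \<in> I \<Longrightarrow> finite (B i) \<and> card I * h \<le> card (B i)"
  shows "\<exists>C. (\<forall>i\<in>I. C i \<subseteq> B i \<and> card (C i) = h) \<and> disjoint_family_on C I"
proof -
  let ?A = "\<lambda>p. B (fst p)"
  have "card J \<le> card (\<Union>(?A ` J))" if J: "J \<subseteq> I \<times> {..<h}" for J
  proof (cases "J = {}")
    case False
    then obtain i a where ia: "(i, a) \<in> J" by auto
    have "card J \<le> card (I \<times> {..<h})" using J assms(1) by (intro card_mono) auto
    also have "\<dots> \<le> card (B i)" using B ia J by (auto simp: card_cartesian_product)
    also have "\<dots> \<le> card (\<Union>(?A ` J))"
    proof (rule card_mono)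
      have "finite J" using J assms(1) by (auto intro: finite_subset)
      then show "finite (\<Union>(?A ` J))" using J B by auto
    qed (use ia in force)
    finally show ?thesis .
  qed simp
  then obtain f where f: "inj_on f (I \<times> {..<h})" "\<forall>p\<in>I \<times> {..<h}. f p \<in> ?A p"
    using hall[of "I \<times> {..<h}" ?A] assms by auto
  let ?C = "\<lambda>i. f ` ({i} \<times> {..<h})"
  have "card (?C i) = h" if "i \<in> I" for i
    using f(1) that by (subst card_image) (auto simp: inj_on_def)
  moreover have "disjoint_family_on ?C I"
    using f(1) by (fastforce simp: disjoint_family_on_def inj_on_def)
  ultimately show ?thesis using f(2) by (intro exI[of _ ?C]) auto
qed

section \<open>Random samples of blocks\<close>

text \<open>Arcs inside a sampled block are discarded: in a blow-up of the sample they would have to be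
  present between different blocks.\<close>

definition reduced :: "('b \<times> nat \<Rightarrow> 'b \<times> nat \<Rightarrow> bool) \<Rightarrow> (nat \<Rightarrow> 'b) \<Rightarrow> nat \<times> nat \<Rightarrow> nat \<times> nat \<Rightarrow> bool" where
  "reduced E f u v \<longleftrightarrow> fst u \<noteq> fst v \<and> E (f (fst u), snd u) (f (fst v), snd v)"

text \<open>The exceptional vertices of a sample. Half of the excess \<open>\<epsilon>\<close> is
  given up to sampling errors; the other half is kept to survive the deletion of these
  vertices.\<close>

definition low_degree :: "real \<Rightarrow> nat \<Rightarrow> nat \<Rightarrow> (nat \<times> nat \<Rightarrow> nat \<times> nat \<Rightarrow> bool) \<Rightarrow> (nat \<times> nat) set" where
  "low_degree \<epsilon> s h F = {w \<in> {..<s} \<times> {..<h}.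
     real (deg_in F ({..<s} \<times> {..<h}) w) < (1 + \<epsilon> / 2) * s * h}"

text \<open>Once the block \<open>f j\<close> is fixed, the degree is a sum of independent terms,
  one for each other sampled block.\<close>

lemma deg_in_reduced:
  assumes j: "j < s"
  shows "deg_in (reduced E f) ({..<s} \<times> {..<h}) (j, a)
    = (\<Sum>i\<in>{..<s}-{j}. deg_in E ({f i} \<times> {..<h}) (f j, a))"
proof -
  have "deg_in (reduced E f) ({..<s} \<times> {..<h}) (j, a)
      = (\<Sum>i<s. deg_in (reduced E f) ({i} \<times> {..<h}) (j, a))"
    by (rule deg_in_Times) auto
  also have "\<dots> = deg_in (reduced E f) ({j} \<times> {..<h}) (j, a)
      + (\<Sum>i\<in>{..<s}-{j}. deg_in (reduced E f) ({i} \<times> {..<h}) (j, a))"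
    using j by (simp add: sum.remove)
  also have "deg_in (reduced E f) ({j} \<times> {..<h}) (j, a) = 0"
    by (simp add: deg_in_singleton_Times reduced_def)
  also have "(\<Sum>i\<in>{..<s}-{j}. deg_in (reduced E f) ({i} \<times> {..<h}) (j, a))
      = (\<Sum>i\<in>{..<s}-{j}. deg_in E ({f i} \<times> {..<h}) (f j, a))"
    by (rule sum.cong) (auto simp: deg_in_singleton_Times reduced_def)
  finally show ?thesis by simp
qed

lemma deg_in_singleton_Times_le: "deg_in E ({y} \<times> {..<h}) v \<le> 2 * h"
proof -
  have "card {b \<in> {..<h}. P b} \<le> h" for P :: "nat \<Rightarrow> bool"
    using card_mono[of "{..<h}" "{b \<in> {..<h}. P b}"] by auto
  from this[of "\<lambda>b. E v (y, b)"] this[of "\<lambda>b. E (y, b) v"] show ?thesis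
    unfolding deg_in_singleton_Times by linarith
qed

text \<open>Conditioned on the block \<open>f j\<close>, Chebyshev's inequality applies to the
  remaining \<open>s - 1\<close> blocks: each contributes at most \<open>2 * h\<close>, and at least
  \<open>(1 + \<epsilon>) * h\<close> on average.\<close>

lemma card_low_degree_le:
  fixes \<epsilon> :: real and X :: "'b set"
  assumes \<epsilon>: "0 < \<epsilon>" "\<epsilon> \<le> 1" and h: "h \<ge> 1" and s: "real s \<ge> 8 / \<epsilon>"
    and X: "finite X" "X \<noteq> {}" and j: "j < s" and a: "a < h"
    and deg: "\<And>v. v \<in> X \<times> {..<h} \<Longrightarrow> (1 + \<epsilon>) * h * card X \<le> deg_in E (X \<times> {..<h}) v"
  shows "real (card {f \<in> PiE {..<s} (\<lambda>_. X). (j, a) \<in> low_degree \<epsilon> s h (reduced E f)})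
    \<le> 64 / (\<epsilon>\<^sup>2 * s) * real (card X) ^ s"
proof -
  let ?r = "real (card X)" and ?S = "{..<s} - {j}"
  let ?N = "PiE ?S (\<lambda>_. X)"
  let ?D = "\<lambda>x y. real (deg_in E ({y} \<times> {..<h}) (x, a))"
  let ?\<tau> = "(1 + \<epsilon> / 2) * s * h"
  have cS: "card ?S = s - 1" "real (s - 1) = real s - 1" "s = Suc (s - 1)" using j by auto
  have s\<epsilon>: "\<epsilon> * s \<ge> 8" using s \<epsilon> by (simp add: field_simps)
  have spos: "real s > 0" using j by simp
  have low: "real (card {f \<in> ?N. (\<Sum>i\<in>?S. ?D x (f i)) < ?\<tau>}) \<le> 64 / (\<epsilon>\<^sup>2 * s) * ?r ^ (s - 1)"
    if x: "x \<in> X" for x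
  proof -
    let ?c = "real (card {f \<in> ?N. (\<Sum>i\<in>?S. ?D x (f i)) < ?\<tau>})"
    \<comment> \<open>The missing block \<open>j\<close> costs \<open>(1 + \<epsilon>) * h\<close>;
      as \<open>\<epsilon> * s \<ge> 8\<close>, this is at most half of the slack
      \<open>\<epsilon> * s * h / 2\<close>.\<close>
    have gap: "(1 + \<epsilon>) * h * card ?S - ?\<tau> \<ge> \<epsilon> * s * h / 4"
    proof -
      have "1 + \<epsilon> \<le> \<epsilon> * s / 4" using s\<epsilon> \<epsilon> by linarith
      then have "h * (1 + \<epsilon>) \<le> h * (\<epsilon> * s / 4)" by (rule mult_left_mono) simp
      then show ?thesis unfolding cS(1,2) by (simp add: algebra_simps)
    qed
    have gap0: "\<epsilon> * s * h / 4 > 0" using \<epsilon> spos h by simp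
    have "?c * (\<epsilon> * s * h / 4)\<^sup>2 \<le> ?c * ((1 + \<epsilon>) * h * card ?S - ?\<tau>)\<^sup>2"
      using gap gap0 by (intro mult_left_mono power_mono) auto
    also have "\<dots> \<le> card ?S * (2 * real h)\<^sup>2 * ?r ^ card ?S"
    proof (rule card_low_sum_le)
      show "(1 + \<epsilon>) * h * card X \<le> (\<Sum>y\<in>X. ?D x y)"
        using deg[of "(x, a)"] x a deg_in_Times[OF X(1), of "{..<h}" E "(x, a)"] by simp
      show "?\<tau> \<le> (1 + \<epsilon>) * h * card ?S" using gap gap0 by linarith
      show "0 \<le> ?D x y \<and> ?D x y \<le> 2 * real h" for y
        using deg_in_singleton_Times_le[of E y h "(x, a)"] by linarith
    qed (use X in auto)
    also have "\<dots> \<le> s * (2 * real h)\<^sup>2 * ?r ^ (s - 1)"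
      unfolding cS(1) by (intro mult_right_mono) auto
    \<comment> \<open>The 64 is \<open>2\<^sup>2 * 4\<^sup>2\<close>, from the range
      \<open>2 * h\<close> of the terms and the gap \<open>\<epsilon> * s * h / 4\<close>.\<close>
    finally have "?c * (\<epsilon>\<^sup>2 * s) * (s * (real h)\<^sup>2) \<le> 64 * ?r ^ (s - 1) * (s * (real h)\<^sup>2)"
      by (simp add: power2_eq_square field_simps)
    then have "?c * (\<epsilon>\<^sup>2 * s) \<le> 64 * ?r ^ (s - 1)"
      using spos h by (simp add: mult_le_cancel_right)
    then show ?thesis using \<epsilon> spos by (simp add: field_simps)
  qed
  have eq: "(j, a) \<in> low_degree \<epsilon> s h (reduced E (f(j := x))) \<longleftrightarrow> (\<Sum>i\<in>?S. ?D x (f i)) < ?\<tau>" for f x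
  proof -
    have "(\<Sum>i\<in>?S. deg_in E ({(f(j := x)) i} \<times> {..<h}) (x, a)) = (\<Sum>i\<in>?S. deg_in E ({f i} \<times> {..<h}) (x, a))"
      by (rule sum.cong) auto
    then show ?thesis
      unfolding low_degree_def using j a by (simp add: deg_in_reduced flip: of_nat_sum)
  qed
  have finN: "finite ?N" using X by (simp add: finite_PiE)
  have jS: "j \<notin> ?S" by simp
  have "real (card {f \<in> PiE {..<s} (\<lambda>_. X). (j, a) \<in> low_degree \<epsilon> s h (reduced E f)})
      = (\<Sum>f\<in>PiE (insert j ?S) (\<lambda>_. X). of_bool ((j, a) \<in> low_degree \<epsilon> s h (reduced E f)))"
    using X by (subst real_card_eq_sum) (auto simp: finite_PiE insert_absorb j)
  also have "\<dots> = (\<Sum>x\<in>X. real (card {f \<in> ?N. (\<Sum>i\<in>?S. ?D x (f i)) < ?\<tau>}))"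
    unfolding sum_PiE_insert[OF jS] eq real_card_eq_sum[OF finN] ..
  also have "\<dots> \<le> (\<Sum>x\<in>X. 64 / (\<epsilon>\<^sup>2 * s) * ?r ^ (s - 1))" by (intro sum_mono low)
  also have "\<dots> = 64 / (\<epsilon>\<^sup>2 * s) * ?r ^ s" by (subst (4) cS(3)) simp
  finally show ?thesis .
qed

lemma card_PiE_fixed_coordinate:
  assumes "finite X" "Y \<subseteq> X" "i < s"
  shows "card {f \<in> PiE {..<s} (\<lambda>_. X). f i \<in> Y} = card Y * card X ^ (s - 1)"
proof -
  have "{f \<in> PiE {..<s} (\<lambda>_. X). f i \<in> Y} = PiE {..<s} (\<lambda>j. if j = i then Y else X)"
  proof (rule set_eqI)
    fix f
    have "(\<forall>j\<in>{..<s}. f j \<in> (if j = i then Y else X)) \<longleftrightarrow> (\<forall>j\<in>{..<s}. f j \<in> X) \<and> f i \<in> Y"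
      using assms(2,3) by (auto split: if_splits)
    then show "f \<in> {f \<in> PiE {..<s} (\<lambda>_. X). f i \<in> Y}
        \<longleftrightarrow> f \<in> PiE {..<s} (\<lambda>j. if j = i then Y else X)"
      unfolding mem_Collect_eq PiE_iff by blast
  qed
  moreover have "(\<Prod>j<s. card (if j = i then Y else X)) = card Y * (\<Prod>j\<in>{..<s}-{i}. card X)"
    using assms(3) by (subst prod.remove[of _ i]) (auto intro!: prod.cong)
  ultimately show ?thesis using assms(3) by (simp add: card_PiE)
qed

text \<open>First moments suffice. On average a sample has at least \<open>\<epsilon> * s\<close>
  positions in \<open>Y\<close> and few low vertices, so \<open>?val\<close> has mean at least
  \<open>\<epsilon>\<^sup>2 * h * s / 4\<close>; since \<open>?val\<close> never exceeds
  \<open>\<epsilon> / 2 * h * s\<close>, it is positive for a proportion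
  \<open>\<epsilon> / 2\<close> of the samples.\<close>

lemma many_good_samples:
  fixes \<epsilon> :: real and X :: "'b set"
  assumes \<epsilon>: "0 < \<epsilon>" "\<epsilon> \<le> 1" and h: "h \<ge> 1" and s: "real s \<ge> 256 / \<epsilon> ^ 4"
    and X: "finite X" "X \<noteq> {}" and Y: "Y \<subseteq> X" "\<epsilon> * card X \<le> card Y"
    and deg: "\<And>v. v \<in> X \<times> {..<h} \<Longrightarrow> (1 + \<epsilon>) * h * card X \<le> deg_in E (X \<times> {..<h}) v"
  shows "\<epsilon> / 2 * real (card X) ^ s \<le> real (card {f \<in> PiE {..<s} (\<lambda>_. X).
    real (card (low_degree \<epsilon> s h (reduced E f))) < \<epsilon> / 2 * h * card {i. i < s \<and> f i \<in> Y}})"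
proof -
  let ?r = "real (card X)" and ?N = "PiE {..<s} (\<lambda>_. X)"
  let ?low = "\<lambda>f. low_degree \<epsilon> s h (reduced E f)" and ?J = "\<lambda>f. {i. i < s \<and> f i \<in> Y}"
  let ?val = "\<lambda>f. \<epsilon> / 2 * h * card (?J f) - card (?low f)"
  let ?G = "{f \<in> ?N. real (card (?low f)) < \<epsilon> / 2 * h * card (?J f)}"
  have r: "?r > 0" using X by (simp add: card_gt_0_iff)
  have e4: "\<epsilon> ^ 4 \<le> \<epsilon>" using \<epsilon> power_decreasing[of 1 4 \<epsilon>] by simp
  have "8 / \<epsilon> \<le> 256 / \<epsilon> ^ 4" using e4 \<epsilon> by (intro frac_le) auto
  then have s8: "real s \<ge> 8 / \<epsilon>" using s by linarith
  have "8 / \<epsilon> > 0" using \<epsilon> by simp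
  then have spos: "real s > 0" using s8 by linarith
  then have sSuc: "s = Suc (s - 1)" by simp
  have finN: "finite ?N" using X by (simp add: finite_PiE)
  have "(\<Sum>f\<in>?N. real (card (?low f))) = (\<Sum>f\<in>?N. \<Sum>w\<in>{..<s}\<times>{..<h}. of_bool (w \<in> ?low f))"
  proof (rule sum.cong)
    fix f assume "f \<in> ?N"
    have "?low f = {w \<in> {..<s}\<times>{..<h}. w \<in> ?low f}" by (auto simp: low_degree_def)
    then show "real (card (?low f)) = (\<Sum>w\<in>{..<s}\<times>{..<h}. of_bool (w \<in> ?low f))"
      using real_card_eq_sum[of "{..<s}\<times>{..<h}" "\<lambda>w. w \<in> ?low f"] by simp
  qed simp
  also have "\<dots> = (\<Sum>w\<in>{..<s}\<times>{..<h}. real (card {f \<in> ?N. w \<in> ?low f}))"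
    unfolding real_card_eq_sum[OF finN] by (rule sum.swap)
  also have "\<dots> \<le> (\<Sum>w\<in>{..<s}\<times>{..<h}. 64 / (\<epsilon>\<^sup>2 * s) * ?r ^ s)"
  proof (rule sum_mono)
    fix w assume w: "w \<in> {..<s} \<times> {..<h}"
    obtain j a where ja: "w = (j, a)" by (cases w)
    show "real (card {f \<in> ?N. w \<in> ?low f}) \<le> 64 / (\<epsilon>\<^sup>2 * s) * ?r ^ s"
      unfolding ja by (rule card_low_degree_le) (use \<epsilon> h s8 X deg w ja in auto)
  qed
  also have "\<dots> = 64 * h / \<epsilon>\<^sup>2 * ?r ^ s" using spos by (simp add: card_cartesian_product)
  \<comment> \<open>Here \<open>s \<ge> 256 / \<epsilon> ^ 4\<close> enters: the mean number of low
    vertices is at most half of \<open>\<epsilon> / 2 * h\<close> times the lower bound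
    \<open>\<epsilon> * s\<close> for the mean of \<open>card (?J f)\<close>.\<close>
  also have "\<dots> \<le> \<epsilon>\<^sup>2 * h * s / 4 * ?r ^ s"
  proof (rule mult_right_mono)
    have "256 \<le> \<epsilon>\<^sup>2 * s * \<epsilon>\<^sup>2" using s \<epsilon> by (simp add: field_simps power4_eq_xxxx power2_eq_square)
    then have "256 / \<epsilon>\<^sup>2 \<le> \<epsilon>\<^sup>2 * s" using \<epsilon> by (simp add: divide_le_eq)
    then have "h / 4 * (256 / \<epsilon>\<^sup>2) \<le> h / 4 * (\<epsilon>\<^sup>2 * s)" by (intro mult_left_mono) auto
    then show "64 * h / \<epsilon>\<^sup>2 \<le> \<epsilon>\<^sup>2 * h * s / 4" by (simp add: field_simps)
  qed simp
  finally have low: "(\<Sum>f\<in>?N. real (card (?low f))) \<le> \<epsilon>\<^sup>2 * h * s / 4 * ?r ^ s" .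
  have "(\<Sum>f\<in>?N. real (card (?J f))) = (\<Sum>f\<in>?N. \<Sum>i<s. of_bool (f i \<in> Y))"
    by (rule sum.cong) (simp_all add: Collect_conj_eq lessThan_def)
  also have "\<dots> = (\<Sum>i<s. real (card {f \<in> ?N. f i \<in> Y}))"
    unfolding real_card_eq_sum[OF finN] by (rule sum.swap)
  also have "\<dots> = s * (card Y * ?r ^ (s - 1))"
    using card_PiE_fixed_coordinate[OF X(1) Y(1), of _ s] by simp
  also have "\<dots> \<ge> s * (\<epsilon> * ?r * ?r ^ (s - 1))"
    using Y(2) by (intro mult_left_mono mult_right_mono) auto
  also have "s * (\<epsilon> * ?r * ?r ^ (s - 1)) = s * \<epsilon> * ?r ^ s" by (subst (4) sSuc) simp
  finally have "\<epsilon> / 2 * h * (s * \<epsilon> * ?r ^ s) \<le> \<epsilon> / 2 * h * (\<Sum>f\<in>?N. real (card (?J f)))"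
    using \<epsilon> by (intro mult_left_mono) auto
  moreover have "\<epsilon> / 2 * h * (s * \<epsilon> * ?r ^ s) = 2 * (\<epsilon>\<^sup>2 * h * s / 4 * ?r ^ s)"
    by (simp add: power2_eq_square)
  moreover have "(\<Sum>f\<in>?N. ?val f)
      = \<epsilon> / 2 * h * (\<Sum>f\<in>?N. real (card (?J f))) - (\<Sum>f\<in>?N. real (card (?low f)))"
    by (simp only: sum_subtractf sum_distrib_left)
  ultimately have "\<epsilon>\<^sup>2 * h * s / 4 * ?r ^ s \<le> (\<Sum>f\<in>?N. ?val f)"
    using low by linarith
  \<comment> \<open>\<open>?val\<close> is at most \<open>\<epsilon> / 2 * h * s\<close> on
    \<open>?G\<close> and not positive elsewhere.\<close>
  also have "\<dots> \<le> (\<Sum>f\<in>?N. \<epsilon> / 2 * h * s * of_bool (f \<in> ?G))"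
  proof (rule sum_mono)
    fix f assume f: "f \<in> ?N"
    show "?val f \<le> \<epsilon> / 2 * h * s * of_bool (f \<in> ?G)"
    proof (cases "f \<in> ?G")
      case True
      have "card (?J f) \<le> card {..<s}" by (rule card_mono) auto
      then have "\<epsilon> / 2 * h * card (?J f) \<le> \<epsilon> / 2 * h * s" using \<epsilon> by (intro mult_left_mono) auto
      then show ?thesis using True by simp
    qed (use f in auto)
  qed
  also have "\<dots> = \<epsilon> / 2 * h * s * card ?G"
    unfolding sum_distrib_left[symmetric] real_card_eq_sum[OF finN]
    by (intro arg_cong2[of _ _ _ _ "(*)"] sum.cong) auto
  finally have "(\<epsilon> / 2 * h * s) * (\<epsilon> / 2 * ?r ^ s) \<le> (\<epsilon> / 2 * h * s) * card ?G"
    by (simp add: power2_eq_square field_simps)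
  moreover have "\<epsilon> / 2 * h * s > 0" using \<epsilon> h spos by simp
  ultimately show ?thesis by (simp only: mult_le_cancel_left_pos)
qed

text \<open>Samples are coloured by their reduced digraph on \<open>{..<s} \<times> {..<h}\<close>
  together with the positions that lie in \<open>Y\<close>. The number of colours depends only on
  \<open>s\<close> and \<open>h\<close>, so some colour class of good samples is dense and contains
  a box; \<open>F\<close> and \<open>J\<close> record its colour.\<close>

lemma homogeneous_blocks:
  fixes \<epsilon> :: real
  assumes \<epsilon>: "0 < \<epsilon>" "\<epsilon> \<le> 1" and h: "h \<ge> 1"
  shows "\<exists>s r0. \<forall>(X::'b set) Y E. finite X \<and> r0 \<le> card X \<and> Y \<subseteq> X \<and> \<epsilon> * card X \<le> card Y \<and>
     (\<forall>v\<in>X \<times> {..<h}. (1 + \<epsilon>) * h * card X \<le> deg_in E (X \<times> {..<h}) v) \<longrightarrow>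
     (\<exists>C F J. (\<forall>i<s. C i \<subseteq> X \<and> card (C i) = h) \<and> disjoint_family_on C {..<s} \<and> J \<subseteq> {..<s} \<and>
        (\<forall>i<s. \<forall>x\<in>C i. x \<in> Y \<longleftrightarrow> i \<in> J) \<and>
        (\<forall>i<s. \<forall>j<s. \<forall>x\<in>C i. \<forall>y\<in>C j. \<forall>a<h. \<forall>b<h. F (i, a) (j, b) \<longrightarrow> E (x, a) (y, b)) \<and>
        real (card (low_degree \<epsilon> s h F)) < \<epsilon> / 2 * h * card J)"
proof -
  define s where "s = nat \<lceil>256 / \<epsilon> ^ 4\<rceil>"
  have s: "real s \<ge> 256 / \<epsilon> ^ 4" unfolding s_def by linarith
  let ?V = "{..<s} \<times> {..<h}"
  define K where "K = Pow (?V \<times> ?V) \<times> Pow {..<s}"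
  have finK: "finite K" by (simp add: K_def)
  have K: "card K > 0" using finK by (auto simp: K_def card_gt_0_iff)
  define c where "c = \<epsilon> / 2 / card K"
  have "c > 0" using \<epsilon> K by (simp add: c_def)
  \<comment> \<open>Sides of size \<open>s * h\<close> leave room for pairwise disjoint sets of size
    \<open>h\<close> at all \<open>s\<close> positions.\<close>
  then have "\<exists>r0. \<forall>(X::'b set) P. finite X \<and> card X \<ge> r0 \<and>
      c * real (card X) ^ s \<le> real (card {f\<in>PiE {..<s} (\<lambda>_. X). P f}) \<longrightarrow>
      (\<exists>B. (\<forall>i<s. B i \<subseteq> X \<and> card (B i) = s * h) \<and> (\<forall>f\<in>PiE {..<s} B. P f))"
    by (rule dense_contains_box[THEN spec, THEN mp])
  then obtain r1 where r1: "\<forall>(X::'b set) P. finite X \<and> card X \<ge> r1 \<and>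
      c * real (card X) ^ s \<le> real (card {f\<in>PiE {..<s} (\<lambda>_. X). P f}) \<longrightarrow>
      (\<exists>B. (\<forall>i<s. B i \<subseteq> X \<and> card (B i) = s * h) \<and> (\<forall>f\<in>PiE {..<s} B. P f))"
    by (rule exE)
  show ?thesis
  proof (rule exI[of _ s], rule exI[of _ "r1 + 1"], intro allI impI, elim conjE)
    fix X Y :: "'b set" and E
    assume X: "finite X" and big: "r1 + 1 \<le> card X" and Y: "Y \<subseteq> X" "\<epsilon> * card X \<le> card Y"
      and deg: "\<forall>v\<in>X \<times> {..<h}. (1 + \<epsilon>) * h * card X \<le> deg_in E (X \<times> {..<h}) v"
    let ?N = "PiE {..<s} (\<lambda>_. X)"
    define col where "col f = ({(u, v) \<in> ?V \<times> ?V. reduced E f u v}, {i. i < s \<and> f i \<in> Y})" for f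
    define G where "G = {f \<in> ?N.
      real (card (low_degree \<epsilon> s h (reduced E f))) < \<epsilon> / 2 * h * card {i. i < s \<and> f i \<in> Y}}"
    have Xne: "X \<noteq> {}" using big by auto
    have G: "\<epsilon> / 2 * real (card X) ^ s \<le> card G"
      unfolding G_def by (rule many_good_samples) (use \<epsilon> h s X Xne Y deg in auto)
    have finG: "finite G" using X by (simp add: G_def finite_PiE)
    have "card X > 0" using big by linarith
    then have "0 < \<epsilon> / 2 * real (card X) ^ s" using \<epsilon> by simp
    then have "real (card G) > 0" using G by linarith
    then have "G \<noteq> {}" by auto
    moreover have "col f \<in> K" for f unfolding K_def col_def by auto
    ultimately obtain c0 where c0: "c0 \<in> K" "card G \<le> card K * card {f \<in> G. col f = c0}"
      using pigeonhole_card[OF finG finK, of "\<lambda>f c. col f = c"] by auto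
    have "\<epsilon> / 2 * real (card X) ^ s \<le> real (card K) * card {f \<in> G. col f = c0}"
      using G c0(2) by (smt (verit) of_nat_le_iff of_nat_mult)
    then have "c * real (card X) ^ s \<le> card {f \<in> G. col f = c0}"
      using K by (simp add: c_def field_simps)
    also have "{f \<in> G. col f = c0} = {f \<in> ?N. f \<in> G \<and> col f = c0}" by (auto simp: G_def)
    finally have "\<exists>B. (\<forall>i<s. B i \<subseteq> X \<and> card (B i) = s * h) \<and> (\<forall>f\<in>PiE {..<s} B. f \<in> G \<and> col f = c0)"
      using X big by (intro r1[THEN spec, THEN spec, THEN mp] conjI) linarith+
    then obtain B where B: "\<forall>i<s. B i \<subseteq> X \<and> card (B i) = s * h"
        and hom: "\<forall>f\<in>PiE {..<s} B. f \<in> G \<and> col f = c0"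
      by (elim exE conjE)
    have "finite (B i) \<and> card {..<s} * h \<le> card (B i)" if "i < s" for i
      using B that X by (auto intro: finite_subset)
    then obtain C where C: "\<forall>i<s. C i \<subseteq> B i \<and> card (C i) = h" "disjoint_family_on C {..<s}"
      using disjoint_subsets_exist[of "{..<s}" B h] by auto
    have "C i \<noteq> {}" if "i < s" for i using C(1) that h by fastforce
    then have "\<forall>i\<in>{..<s}. \<exists>x. x \<in> C i" by blast
    from bchoice[OF this] obtain p where "\<forall>i\<in>{..<s}. p i \<in> C i" by blast
    then have p: "p i \<in> C i" if "i < s" for i using that by simp
    have CB: "x \<in> B i" if "x \<in> C i" "i < s" for x i using C(1) that by blast
    have PiB: "restrict f {..<s} \<in> PiE {..<s} B" if "\<And>i. i < s \<Longrightarrow> f i \<in> C i" for f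
      unfolding restrict_PiE_iff using that CB by simp
    define J where "J = snd c0"
    define F where "F u v \<longleftrightarrow> (u, v) \<in> fst c0" for u v
    have F: "F u v \<longleftrightarrow> reduced E f u v" if "f \<in> PiE {..<s} B" "u \<in> ?V" "v \<in> ?V" for f u v
      using hom that unfolding F_def col_def by force
    have J: "J = {i. i < s \<and> f i \<in> Y}" if "f \<in> PiE {..<s} B" for f
      using hom that unfolding J_def col_def by force
    \<comment> \<open>One representative sample from the box; its goodness passes to
      \<open>F\<close> and \<open>J\<close>.\<close>
    define q where "q = restrict p {..<s}"
    have qB: "q \<in> PiE {..<s} B" unfolding q_def by (rule PiB) (rule p)
    have "deg_in F ?V w = deg_in (reduced E q) ?V w" if "w \<in> ?V" for w
    proof -
      have "{u \<in> ?V. F w u} = {u \<in> ?V. reduced E q w u}"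
           "{u \<in> ?V. F u w} = {u \<in> ?V. reduced E q u w}"
        using F[OF qB] that by auto
      then show ?thesis unfolding deg_in_def by simp
    qed
    then have lowF: "low_degree \<epsilon> s h F = low_degree \<epsilon> s h (reduced E q)"
      unfolding low_degree_def by auto
    have "q \<in> G" using hom qB by blast
    then have low: "real (card (low_degree \<epsilon> s h F)) < \<epsilon> / 2 * h * card J"
      unfolding G_def lowF J[OF qB] mem_Collect_eq by (rule conjunct2)
    \<comment> \<open>Exchanging one coordinate of \<open>p\<close> stays inside the box, so the
      colour is unchanged.\<close>
    have YJ: "x \<in> Y \<longleftrightarrow> i \<in> J" if "i < s" "x \<in> C i" for i x
    proof -
      have "restrict (p(i := x)) {..<s} \<in> PiE {..<s} B" by (rule PiB) (use p that in simp)
      from J[OF this] show ?thesis using that by simp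
    qed
    \<comment> \<open>Likewise with two coordinates exchanged; the case \<open>i = j\<close> cannot
      occur, because \<open>reduced\<close> has no arc inside a block.\<close>
    have FE: "E (x, a) (y, b)"
      if "i < s" "j < s" "x \<in> C i" "y \<in> C j" "a < h" "b < h" "F (i, a) (j, b)" for i j x y a b
    proof -
      let ?f = "restrict (p(i := x, j := y)) {..<s}"
      have "?f \<in> PiE {..<s} B" by (rule PiB) (use p that in simp)
      from F[OF this, of "(i, a)" "(j, b)"] have "reduced E ?f (i, a) (j, b)" using that by simp
      then show ?thesis using that(1,2) by (auto simp: reduced_def)
    qed
    show "\<exists>C F J. (\<forall>i<s. C i \<subseteq> X \<and> card (C i) = h) \<and> disjoint_family_on C {..<s} \<and> J \<subseteq> {..<s} \<and>
        (\<forall>i<s. \<forall>x\<in>C i. x \<in> Y \<longleftrightarrow> i \<in> J) \<and>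
        (\<forall>i<s. \<forall>j<s. \<forall>x\<in>C i. \<forall>y\<in>C j. \<forall>a<h. \<forall>b<h. F (i, a) (j, b) \<longrightarrow> E (x, a) (y, b)) \<and>
        real (card (low_degree \<epsilon> s h F)) < \<epsilon> / 2 * h * card J"
    proof (intro exI[of _ C] exI[of _ F] exI[of _ J] conjI)
      show "\<forall>i<s. C i \<subseteq> X \<and> card (C i) = h" using C(1) B by blast
      show "J \<subseteq> {..<s}" using J[OF qB] by blast
      show "\<forall>i<s. \<forall>x\<in>C i. x \<in> Y \<longleftrightarrow> i \<in> J" by (intro allI impI ballI YJ)
      show "\<forall>i<s. \<forall>j<s. \<forall>x\<in>C i. \<forall>y\<in>C j. \<forall>a<h. \<forall>b<h. F (i, a) (j, b) \<longrightarrow> E (x, a) (y, b)"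
        by (intro allI impI ballI FE)
      show "disjoint_family_on C {..<s}" by (fact C(2))
      show "real (card (low_degree \<epsilon> s h F)) < \<epsilon> / 2 * h * card J" by (fact low)
    qed
  qed
qed

section \<open>Blow-ups as vertex sets, and tilings from 1-factors\<close>

text \<open>Only the vertex set of a tile is kept, and it may span further arcs, as copies need not
  be induced. A tiling thus becomes a disjoint family of sets.\<close>

definition blowup_set :: "nat \<Rightarrow> (nat \<Rightarrow> nat) \<Rightarrow> ('a \<Rightarrow> 'a \<Rightarrow> bool) \<Rightarrow> 'a set \<Rightarrow> bool" where
  "blowup_set k t E T \<longleftrightarrow> (\<exists>A. T = (\<Union>i\<in>{1..k}. A i) \<and> (\<forall>i\<in>{1..k}. finite (A i) \<and> card (A i) = t i) \<and>
     disjoint_family_on A {1..k} \<and> (\<forall>i\<in>{1..<k}. \<forall>x\<in>A i. \<forall>y\<in>A (Suc i). E x y))"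

lemma blowup_set_card:
  assumes "blowup_set k t E T"
  shows "finite T \<and> card T = sum t {1..k}"
proof -
  obtain A where A: "T = (\<Union>i\<in>{1..k}. A i)" "\<forall>i\<in>{1..k}. finite (A i) \<and> card (A i) = t i"
      "disjoint_family_on A {1..k}"
    using assms unfolding blowup_set_def by blast
  have "card T = (\<Sum>i\<in>{1..k}. card (A i))"
    unfolding A(1) using A(2,3) by (intro card_UN_disjoint) (auto simp: disjoint_family_on_def)
  then show ?thesis using A(1,2) by simp
qed

lemma split_into_parts:
  assumes "finite L" "finite S" "sum t L \<le> card S"
  shows "\<exists>p. (\<forall>l\<in>L. p l \<subseteq> S \<and> card (p l) = t l) \<and> disjoint_family_on p L"
  using assms
proof (induction L arbitrary: S rule: finite_induct)
  case empty
  then show ?case by (simp add: disjoint_family_on_def)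
next
  case (insert l L)
  have "t l \<le> card S" using insert by simp
  then obtain B where B: "B \<subseteq> S" "card B = t l" "finite B" using obtain_subset_with_card_n by metis
  have "sum t L \<le> card (S - B)" using insert B by (simp add: card_Diff_subset)
  then obtain p where p: "\<forall>m\<in>L. p m \<subseteq> S - B \<and> card (p m) = t m" "disjoint_family_on p L"
    using insert.IH[of "S - B"] insert.prems by blast
  let ?q = "p(l := B)"
  have "\<forall>m\<in>insert l L. ?q m \<subseteq> S \<and> card (?q m) = t m" using p B insert.hyps by auto
  moreover have "disjoint_family_on ?q (insert l L)"
    using p B insert.hyps unfolding disjoint_family_on_def by (auto split: if_splits)
  ultimately show ?case by blast
qed

text \<open>Each cluster is cut into parts of sizes \<^term>\<open>t 1\<close> to \<^term>\<open>t k\<close>; the tile started at a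
  cluster takes its \<open>l\<close>-th part from the \<open>l\<close>-th cluster of the walk along \<open>\<sigma>\<close>.\<close>

lemma blowup_sets_of_one_factor:
  fixes U :: "'w \<Rightarrow> 'a set"
  assumes W: "finite W" "bij_betw \<sigma> W W"
    and U: "\<And>w. w \<in> W \<Longrightarrow> finite (U w) \<and> card (U w) = sum t {1..k}" "disjoint_family_on U W"
    and E: "\<And>w x y. \<lbrakk>w \<in> W; x \<in> U w; y \<in> U (\<sigma> w)\<rbrakk> \<Longrightarrow> E x y"
    and pos: "sum t {1..k} > 0"
  shows "\<exists>\<T>. card \<T> = card W \<and> disjoint \<T> \<and> (\<forall>T\<in>\<T>. blowup_set k t E T \<and> T \<subseteq> \<Union>(U ` W))"
proof -
  have "\<forall>w\<in>W. \<exists>p. (\<forall>l\<in>{1..k}. p l \<subseteq> U w \<and> card (p l) = t l) \<and> disjoint_family_on p {1..k}"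
    using U(1) by (intro ballI split_into_parts) auto
  from bchoice[OF this] obtain p where
    p: "\<And>w l. \<lbrakk>w \<in> W; l \<in> {1..k}\<rbrakk> \<Longrightarrow> p w l \<subseteq> U w \<and> card (p w l) = t l"
      "\<And>w. w \<in> W \<Longrightarrow> disjoint_family_on (p w) {1..k}" by blast
  have iter: "bij_betw (\<sigma> ^^ n) W W" for n
  proof (induction n)
    case (Suc n)
    then show ?case using bij_betw_trans[OF Suc W(2)] by (simp add: comp_def)
  qed (simp add: bij_betw_def)
  have itW: "(\<sigma> ^^ n) w \<in> W" if "w \<in> W" for n w
    using bij_betwE[OF iter[of n]] that by blast
  \<comment> \<open>Parts are numbered from 1, so part \<open>l\<close> lies \<open>l - 1\<close>
    steps along the walk and part 1 in the starting cluster.\<close>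
  define A where "A w l = p ((\<sigma> ^^ (l - 1)) w) l" for w l
  define T where "T w = (\<Union>l\<in>{1..k}. A w l)" for w
  have AU: "A w l \<subseteq> U ((\<sigma> ^^ (l - 1)) w)" "card (A w l) = t l" "finite (A w l)"
    if "w \<in> W" "l \<in> {1..k}" for w l
    using p(1)[OF itW[OF that(1), of "l - 1"] that(2)] U(1)[OF itW[OF that(1), of "l - 1"]]
    unfolding A_def by (auto intro: finite_subset)
  \<comment> \<open>A common vertex determines the cluster, then the part within that cluster, and
    then the start of the walk, because the powers of \<open>\<sigma>\<close> are injective.\<close>
  have meet: "w = w' \<and> l = l'"
    if "x \<in> A w l" "x \<in> A w' l'" "w \<in> W" "w' \<in> W" "l \<in> {1..k}" "l' \<in> {1..k}" for x w w' l l'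
  proof -
    let ?u = "(\<sigma> ^^ (l - 1)) w" and ?u' = "(\<sigma> ^^ (l' - 1)) w'"
    have u: "?u \<in> W" "?u' \<in> W" using itW that by auto
    have "x \<in> U ?u" "x \<in> U ?u'" using AU(1) that by blast+
    then have eq: "?u = ?u'" using U(2) u unfolding disjoint_family_on_def by blast
    then have "x \<in> p ?u l" "x \<in> p ?u l'" using that unfolding A_def by auto
    then have l: "l = l'" using p(2)[OF u(1)] that unfolding disjoint_family_on_def by blast
    with eq have "w = w'" using bij_betw_imp_inj_on[OF iter[of "l - 1"]] that by (auto dest: inj_onD)
    with l show ?thesis by simp
  qed
  have blow: "blowup_set k t E (T w)" if w: "w \<in> W" for w
    unfolding blowup_set_def
  proof (intro exI[of _ "A w"] conjI ballI)
    show "disjoint_family_on (A w) {1..k}"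
      unfolding disjoint_family_on_def using meet w by blast
    fix i x y assume i: "i \<in> {1..<k}" and xy: "x \<in> A w i" "y \<in> A w (Suc i)"
    have "(\<sigma> ^^ i) w = \<sigma> ((\<sigma> ^^ (i - 1)) w)" using i by (cases i) auto
    then have "x \<in> U ((\<sigma> ^^ (i - 1)) w)" "y \<in> U (\<sigma> ((\<sigma> ^^ (i - 1)) w))"
      using AU(1)[OF w, of i] AU(1)[OF w, of "Suc i"] xy i by auto
    then show "E x y" using E itW w by blast
  qed (use AU w in \<open>auto simp: T_def\<close>)
  \<comment> \<open>Disjoint nonempty tiles are distinct, so there are exactly \<open>card W\<close>
    of them.\<close>
  have ne: "T w \<noteq> {}" if "w \<in> W" for w
    using blowup_set_card[OF blow[OF that]] pos by auto
  have disj: "T w \<inter> T w' = {}" if "w \<in> W" "w' \<in> W" "w \<noteq> w'" for w w'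
    using meet that unfolding T_def by blast
  have "inj_on T W" using disj ne by (metis inf.idem inj_onI)
  then have "card (T ` W) = card W" by (rule card_image)
  moreover have "disjoint (T ` W)"
    using disj unfolding disjoint_def by blast
  moreover have "T w \<subseteq> \<Union>(U ` W)" if "w \<in> W" for w
    unfolding T_def using AU(1) itW that by blast
  ultimately show ?thesis using blow by (intro exI[of _ "T ` W"]) auto
qed

section \<open>Enlarging a tiling\<close>

lemma chop_into_sets:
  assumes "finite U" "h > 0"
  shows "\<exists>Q. disjoint Q \<and> (\<forall>B\<in>Q. card B = h \<and> B \<subseteq> U) \<and> card (U - \<Union>Q) < h"
  using assms(1)
proof (induction U rule: finite_psubset_induct)
  case (psubset U)
  show ?case
  proof (cases "card U < h")
    case True
    then show ?thesis by (intro exI[of _ "{}"]) (simp add: disjoint_def)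
  next
    case False
    then obtain B where B: "B \<subseteq> U" "card B = h" "finite B"
      using obtain_subset_with_card_n[of h U] by auto
    then have "B \<noteq> {}" using assms(2) by auto
    then have "U - B \<subset> U" using B(1) by blast
    then obtain Q where Q: "disjoint Q" "\<forall>B'\<in>Q. card B' = h \<and> B' \<subseteq> U - B" "card (U - B - \<Union>Q) < h"
      using psubset.IH by blast
    have "disjoint (insert B Q)" using Q(1,2) unfolding disjoint_def by blast
    moreover have "U - \<Union>(insert B Q) = U - B - \<Union>Q" by blast
    ultimately show ?thesis using Q B by (intro exI[of _ "insert B Q"]) auto
  qed
qed

lemma card_Union_blocks:
  assumes "finite X" "disjoint X" "\<And>B. B \<in> X \<Longrightarrow> card B = h" "h > 0"
  shows "card (\<Union>X) = card X * h"
proof -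
  have "finite B" if "B \<in> X" for B using assms(3,4) that by (metis card.infinite less_irrefl)
  then have "card (\<Union>X) = sum card X"
    using assms(2) by (intro card_Union_disjoint) (auto simp: disjoint_def pairwise_def disjnt_def)
  then show ?thesis using assms(3) by simp
qed

text \<open>\<open>X - Y\<close> is the current tiling and \<open>Y\<close> consists of the chopped
  blocks. At most \<open>(s - card J) * h\<close> old tiles are destroyed, and retiling along a
  1-factor creates \<open>s * h\<close> new ones minus one for each low vertex. The balance is
  positive, since \<open>low\<close> allows fewer than \<open>h * card J\<close> low
  vertices.\<close>

lemma augment:
  fixes \<epsilon> :: real and t :: "nat \<Rightarrow> nat" and k :: nat
  assumes h_def: "h = sum t {1..k}"
    and \<epsilon>: "0 < \<epsilon>" "\<epsilon> \<le> 1" and h: "h \<ge> 1"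
    and X: "finite X" "disjoint X" "\<And>B. B \<in> X \<Longrightarrow> card B = h" and Y: "Y \<subseteq> X"
    and C: "\<And>i. i < s \<Longrightarrow> C i \<subseteq> X \<and> card (C i) = h" "disjoint_family_on C {..<s}"
    and J: "J \<subseteq> {..<s}" "\<And>i x. \<lbrakk>i < s; x \<in> C i\<rbrakk> \<Longrightarrow> x \<in> Y \<longleftrightarrow> i \<in> J"
    and \<phi>: "\<And>B. B \<in> X \<Longrightarrow> bij_betw (\<phi> B) {..<h} B"
    and hom: "\<And>i j x y a b. \<lbrakk>i < s; j < s; x \<in> C i; y \<in> C j; a < h; b < h; F (i, a) (j, b)\<rbrakk>
      \<Longrightarrow> E (\<phi> x a) (\<phi> y b)"
    and low: "real (card (low_degree \<epsilon> s h F)) < \<epsilon> / 2 * h * card J"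
    and blow: "\<And>B. B \<in> X - Y \<Longrightarrow> blowup_set k t E B"
  shows "\<exists>\<P>. disjoint \<P> \<and> (\<forall>T\<in>\<P>. blowup_set k t E T \<and> T \<subseteq> \<Union>X) \<and> card (X - Y) < card \<P>"
proof -
  let ?V = "{..<s} \<times> {..<h}" and ?low = "low_degree \<epsilon> s h F"
  define W where "W = ?V - ?low"
  have lowV: "?low \<subseteq> ?V" by (auto simp: low_degree_def)
  have finW: "finite W" by (simp add: W_def)
  have cardlow: "card ?low \<le> s * h" using card_mono[OF _ lowV] by (simp add: card_cartesian_product)
  have cW: "card W = s * h - card ?low"
    unfolding W_def using lowV by (subst card_Diff_subset) (auto intro: finite_subset simp: card_cartesian_product)
  have VW: "?V - W = ?low" using lowV by (auto simp: W_def)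
  have Js: "card J \<le> s" using J(1) card_mono[of "{..<s}" J] by simp
  \<comment> \<open>Deleting the low vertices costs up to \<open>2 * card ?low\<close> in degree but
    lowers the requirement \<open>card W\<close> by \<open>card ?low\<close>; the slack
    \<open>\<epsilon> / 2 * s * h\<close> covers the difference.\<close>
  have "real (card W) \<le> deg_in F W w" if w: "w \<in> W" for w
  proof -
    have "(1 + \<epsilon> / 2) * s * h \<le> deg_in F ?V w" using w by (auto simp: W_def low_degree_def)
    also have "deg_in F ?V w \<le> deg_in F W w + 2 * card ?low"
      using deg_in_le_Diff[of ?V W F w] unfolding VW by (simp add: W_def)
    finally have "(1 + \<epsilon> / 2) * s * h \<le> deg_in F W w + 2 * real (card ?low)" by simp
    moreover have "\<epsilon> / 2 * h * card J \<le> \<epsilon> / 2 * h * s" using Js \<epsilon> by (intro mult_left_mono) auto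
    moreover have "(1 + \<epsilon> / 2) * s * h = real s * h + \<epsilon> / 2 * h * s" by (simp add: algebra_simps)
    moreover have "real (card W) = real s * h - card ?low"
      unfolding cW using cardlow by (simp add: of_nat_diff)
    ultimately show ?thesis using low by linarith
  qed
  then obtain \<sigma> where \<sigma>: "bij_betw \<sigma> W W" "\<forall>w\<in>W. F w (\<sigma> w)"
    using one_factor_exists[OF finW, of F] by (metis of_nat_le_iff)
  \<comment> \<open>The cluster that replaces \<open>(i, a)\<close>: the vertices numbered
    \<open>a\<close> in the \<open>h\<close> blocks of \<open>C i\<close>.\<close>
  define U where "U w = (\<lambda>B. \<phi> B (snd w)) ` C (fst w)" for w
  have Wd: "fst w < s" "snd w < h" if "w \<in> W" for w using that by (auto simp: W_def)
  have CX: "B \<in> X" if "B \<in> C i" "i < s" for B i using C(1) that by blast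
  have \<phi>in: "\<phi> B a \<in> B" if "B \<in> X" "a < h" for B a using \<phi>[OF that(1)] that(2) by (auto dest: bij_betwE)
  have meet: "B = B' \<and> a = a'"
    if "\<phi> B a = \<phi> B' a'" "B \<in> X" "B' \<in> X" "a < h" "a' < h" for B B' a a'
  proof -
    have "B = B'" using X(2) \<phi>in[of B a] \<phi>in[of B' a'] that unfolding disjoint_def by auto
    moreover have "inj_on (\<phi> B) {..<h}" using \<phi> that by (auto simp: bij_betw_def)
    ultimately show ?thesis using that by (auto dest: inj_onD)
  qed
  have finC: "finite (C i)" if "i < s" for i using C(1)[OF that] X(1) by (auto intro: finite_subset)
  have U1: "finite (U w) \<and> card (U w) = sum t {1..k}" if w: "w \<in> W" for w
  proof -
    have "inj_on (\<lambda>B. \<phi> B (snd w)) (C (fst w))"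
      using meet CX Wd[OF w] by (intro inj_onI) blast
    then show ?thesis
      using C(1) Wd[OF w] finC unfolding U_def h_def[symmetric] by (simp add: card_image)
  qed
  have U2: "disjoint_family_on U W"
    unfolding disjoint_family_on_def
  proof (intro ballI impI, rule ccontr)
    fix w w' assume w: "w \<in> W" "w' \<in> W" "w \<noteq> w'" "U w \<inter> U w' \<noteq> {}"
    then obtain B B' where B: "B \<in> C (fst w)" "B' \<in> C (fst w')" "\<phi> B (snd w) = \<phi> B' (snd w')"
      unfolding U_def by auto
    then have "B = B'" "snd w = snd w'" using meet CX Wd w(1,2) by blast+
    moreover have "fst w = fst w'"
      using C(2) B(1,2) \<open>B = B'\<close> Wd w(1,2) unfolding disjoint_family_on_def by blast
    ultimately show False using w(3) by (simp add: prod_eq_iff)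
  qed
  have "E x y" if "w \<in> W" "x \<in> U w" "y \<in> U (\<sigma> w)" for w x y
  proof -
    have w': "\<sigma> w \<in> W" using \<sigma>(1) that(1) by (auto dest: bij_betwE)
    have "F (fst w, snd w) (fst (\<sigma> w), snd (\<sigma> w))" using \<sigma>(2) that(1) by simp
    then show ?thesis using that hom Wd[OF that(1)] Wd[OF w'] unfolding U_def by blast
  qed
  then obtain \<T> where \<T>: "card \<T> = card W" "disjoint \<T>"
      "\<forall>T\<in>\<T>. blowup_set k t E T \<and> T \<subseteq> \<Union>(U ` W)"
    using blowup_sets_of_one_factor[OF finW \<sigma>(1) U1 U2, of E] h unfolding h_def by auto
  \<comment> \<open>Positions outside \<open>J\<close> carry old tiles only; these are the tiles to
    be destroyed.\<close>
  define D where "D = (\<Union>i\<in>{..<s}-J. C i)"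
  define \<P> where "\<P> = (X - Y - D) \<union> \<T>"
  have UX: "\<Union>(U ` W) \<subseteq> \<Union>(\<Union>i<s. C i)"
  proof
    fix x assume "x \<in> \<Union>(U ` W)"
    then obtain w B where w: "w \<in> W" and B: "B \<in> C (fst w)" "x = \<phi> B (snd w)" unfolding U_def by blast
    then have "x \<in> B" using \<phi>in[OF CX[OF B(1)]] Wd[OF w] by simp
    moreover have "B \<in> (\<Union>i<s. C i)" using B(1) Wd[OF w] by blast
    ultimately show "x \<in> \<Union>(\<Union>i<s. C i)" by blast
  qed
  \<comment> \<open>A block meeting a new tile is a sampled block, and a sampled block outside
    \<open>Y\<close> belongs to \<open>D\<close>.\<close>
  have apart: "B \<inter> T = {}" if "B \<in> X - Y - D" "T \<in> \<T>" for B T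
  proof (rule ccontr)
    assume "B \<inter> T \<noteq> {}"
    then obtain x where x: "x \<in> B" "x \<in> T" by auto
    then have "x \<in> \<Union>(\<Union>i<s. C i)" using \<T>(3) UX that(2) by blast
    then obtain i B' where i: "i < s" "B' \<in> C i" "x \<in> B'" by blast
    then have "B' = B" using X(2) x CX that(1) unfolding disjoint_def by blast
    then show False using i J(2)[OF i(1,2)] that(1) unfolding D_def by blast
  qed
  have "disjoint (X - Y - D)" using X(2) by (auto simp: disjoint_def)
  moreover have "\<Union>(X - Y - D) \<inter> \<Union>\<T> = {}" using apart by blast
  ultimately have disj: "disjoint \<P>"
    unfolding \<P>_def using disjoint_union[OF _ \<T>(2)] by blast
  have "(\<Union>i<s. C i) \<subseteq> X" using C(1) by blast
  then have "\<Union>(U ` W) \<subseteq> \<Union>X" using UX by blast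
  then have TX: "T \<subseteq> \<Union>X" if "T \<in> \<T>" for T using \<T>(3) that by (meson subset_trans)
  then have "\<T> \<subseteq> Pow (\<Union>X)" by blast
  moreover have finUX: "finite (\<Union>X)"
    using X(1,3) h by (metis card.infinite finite_Union not_one_le_zero)
  ultimately have finT: "finite \<T>" by (auto intro: finite_subset)
  have "T \<noteq> {}" if "T \<in> \<T>" for T using \<T>(3) that blowup_set_card h unfolding h_def by fastforce
  then have "(X - Y - D) \<inter> \<T> = {}" using apart by blast
  then have cP: "card \<P> = card (X - Y - D) + card W"
    unfolding \<P>_def \<T>(1)[symmetric] using finT X(1) by (intro card_Un_disjoint) auto
  have "card D \<le> (\<Sum>i\<in>{..<s}-J. card (C i))" unfolding D_def by (rule card_UN_le) simp
  also have "\<dots> = (\<Sum>i\<in>{..<s}-J. h)" by (rule sum.cong) (use C(1) in auto)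
  also have "\<dots> = (s - card J) * h"
    using J(1) by (simp add: card_Diff_subset finite_subset[OF J(1)])
  finally have "real (card D) \<le> (real s - card J) * h"
    using Js by (metis of_nat_diff of_nat_le_iff of_nat_mult)
  moreover have "\<epsilon> / 2 * (real h * card J) \<le> 1 * (real h * card J)"
    using \<epsilon> by (intro mult_right_mono) auto
  moreover have "real (card W) = real s * h - card ?low"
    unfolding cW using cardlow by (simp add: of_nat_diff)
  ultimately have "real (card D) < card W" using low by (simp add: algebra_simps)
  moreover have "card (X - Y) \<le> card (X - Y - D) + card D"
  proof -
    have "finite D" unfolding D_def using finC by auto
    then have "card (X - Y) \<le> card ((X - Y - D) \<union> D)" using X(1) by (intro card_mono) auto
    then show ?thesis using card_Un_le[of "X - Y - D" D] by linarith
  qed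
  ultimately have "card (X - Y) < card \<P>" unfolding cP by linarith
  moreover have "blowup_set k t E T \<and> T \<subseteq> \<Union>X" if "T \<in> \<P>" for T
    using that blow \<T>(3) TX unfolding \<P>_def by blast
  ultimately show ?thesis using disj by blast
qed

lemma bij_betw_blocks:
  assumes "disjoint X" and \<phi>: "\<And>B. B \<in> X \<Longrightarrow> bij_betw (\<phi> B) H B"
  shows "bij_betw (\<lambda>p. \<phi> (fst p) (snd p)) (X \<times> H) (\<Union>X)"
proof (rule bij_betw_imageI)
  have in_block: "\<phi> B a \<in> B" if "B \<in> X" "a \<in> H" for B a
    using \<phi>[OF that(1)] that(2) by (auto dest: bij_betwE)
  show "inj_on (\<lambda>p. \<phi> (fst p) (snd p)) (X \<times> H)"
  proof (rule inj_onI)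
    fix p q assume p: "p \<in> X \<times> H" "q \<in> X \<times> H" "\<phi> (fst p) (snd p) = \<phi> (fst q) (snd q)"
    then have "\<phi> (fst p) (snd p) \<in> fst p \<inter> fst q"
      using in_block[of "fst p" "snd p"] in_block[of "fst q" "snd q"] by auto
    then have eq: "fst p = fst q" using assms(1) p unfolding disjoint_def by fastforce
    moreover have "inj_on (\<phi> (fst p)) H" using \<phi>[of "fst p"] p(1) by (auto simp: bij_betw_def)
    ultimately show "p = q" using p by (auto simp: prod_eq_iff dest: inj_onD)
  qed
  show "(\<lambda>p. \<phi> (fst p) (snd p)) ` (X \<times> H) = \<Union>X"
  proof (intro equalityI subsetI)
    fix x assume "x \<in> \<Union>X"
    then obtain B where B: "B \<in> X" "x \<in> B" by blast
    then obtain a where "a \<in> H" "x = \<phi> B a" using \<phi>[OF B(1)] by (auto simp: bij_betw_def)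
    then show "x \<in> (\<lambda>p. \<phi> (fst p) (snd p)) ` (X \<times> H)"
      using B by (intro image_eqI[of _ _ "(B, a)"]) auto
  next
    fix x assume "x \<in> (\<lambda>p. \<phi> (fst p) (snd p)) ` (X \<times> H)"
    then show "x \<in> \<Union>X" using in_block by force
  qed
qed

section \<open>The extremal argument\<close>

lemma almost_perfect_blowup_tiling:
  fixes \<eta> :: real and t :: "nat \<Rightarrow> nat" and k :: nat
  assumes \<eta>: "0 < \<eta>" "\<eta> \<le> 1" and pos: "sum t {1..k} > 0"
  shows "\<exists>n0. \<forall>(V::'a set) E. finite V \<and> n0 \<le> card V \<and>
      (\<forall>v\<in>V. (1 + \<eta>) * card V \<le> deg_in E V v) \<longrightarrow>
      (\<exists>\<P>. disjoint \<P> \<and> (\<forall>T\<in>\<P>. blowup_set k t E T \<and> T \<subseteq> V) \<and> card (V - \<Union>\<P>) \<le> \<eta> * card V)"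
proof -
  define h where "h = sum t {1..k}"
  \<comment> \<open>The other half of \<open>\<eta>\<close> absorbs the fewer than \<open>h\<close>
    vertices that remain outside all blocks.\<close>
  define \<epsilon> where "\<epsilon> = \<eta> / 2"
  have h: "h \<ge> 1" "h > 0" using pos by (auto simp: h_def)
  have \<epsilon>: "0 < \<epsilon>" "\<epsilon> \<le> 1" using \<eta> by (auto simp: \<epsilon>_def)
  from homogeneous_blocks[OF \<epsilon> h(1)] obtain s r0 where
    hb: "\<forall>(X::'a set set) Y E. finite X \<and> r0 \<le> card X \<and> Y \<subseteq> X \<and> \<epsilon> * card X \<le> card Y \<and>
     (\<forall>v\<in>X \<times> {..<h}. (1 + \<epsilon>) * h * card X \<le> deg_in E (X \<times> {..<h}) v) \<longrightarrow>
     (\<exists>C F J. (\<forall>i<s. C i \<subseteq> X \<and> card (C i) = h) \<and> disjoint_family_on C {..<s} \<and> J \<subseteq> {..<s} \<and>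
        (\<forall>i<s. \<forall>x\<in>C i. x \<in> Y \<longleftrightarrow> i \<in> J) \<and>
        (\<forall>i<s. \<forall>j<s. \<forall>x\<in>C i. \<forall>y\<in>C j. \<forall>a<h. \<forall>b<h. F (i, a) (j, b) \<longrightarrow> E (x, a) (y, b)) \<and>
        real (card (low_degree \<epsilon> s h F)) < \<epsilon> / 2 * h * card J)"
    by (elim exE)
  \<comment> \<open>The first summand forces at least \<open>r0\<close> blocks, the second makes
    \<open>4 * h\<close> at most \<open>\<eta> * card V\<close>.\<close>
  define n0 where "n0 = (r0 + 1) * h + nat \<lceil>4 * real h / \<eta>\<rceil>"
  show ?thesis
  proof (rule exI[of _ n0], intro allI impI, elim conjE)
    fix V :: "'a set" and E
    assume V: "finite V" and big: "n0 \<le> card V"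
      and deg: "\<forall>v\<in>V. (1 + \<eta>) * card V \<le> deg_in E V v"
    let ?n = "real (card V)"
    define \<S> where "\<S> = {\<P>. disjoint \<P> \<and> (\<forall>T\<in>\<P>. blowup_set k t E T \<and> T \<subseteq> V)}"
    have "\<S> \<subseteq> Pow (Pow V)" by (auto simp: \<S>_def)
    then have finS: "finite \<S>" using V by (auto intro: finite_subset)
    have "{} \<in> \<S>" by (simp add: \<S>_def disjoint_def)
    then have "Max (card ` \<S>) \<in> card ` \<S>" using finS by (intro Max_in) auto
    then obtain \<P> where \<P>: "\<P> \<in> \<S>" "card \<P> = Max (card ` \<S>)" by (metis imageE)
    have max: "card \<P>' \<le> card \<P>" if "\<P>' \<in> \<S>" for \<P>'
      unfolding \<P>(2) using that finS by (intro Max_ge) auto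
    have \<P>1: "disjoint \<P>" "\<And>T. T \<in> \<P> \<Longrightarrow> blowup_set k t E T" "\<And>T. T \<in> \<P> \<Longrightarrow> T \<subseteq> V"
      using \<P>(1) by (auto simp: \<S>_def)
    have "card (V - \<Union>\<P>) \<le> \<eta> * ?n"
    proof (rule ccontr)
      assume U: "\<not> ?thesis"
      let ?U = "V - \<Union>\<P>"
      have "finite ?U" using V by simp
      from chop_into_sets[OF this h(2)] obtain Q where
        Q: "disjoint Q" "\<forall>B\<in>Q. card B = h \<and> B \<subseteq> ?U" "card (?U - \<Union>Q) < h" by blast
      define X where "X = \<P> \<union> Q"
      have cardX: "card B = h" if "B \<in> X" for B
        using that Q(2) \<P>1(2) blowup_set_card unfolding X_def h_def by blast
      have XV: "B \<subseteq> V" if "B \<in> X" for B using that Q(2) \<P>1(3) unfolding X_def by blast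
      then have "X \<subseteq> Pow V" by blast
      then have finX: "finite X" using V by (auto intro: finite_subset)
      have apart: "B \<inter> T = {}" if "B \<in> Q" "T \<in> \<P>" for B T using that Q(2) by blast
      then have "\<Union>\<P> \<inter> \<Union>Q = {}" by blast
      then have disjX: "disjoint X"
        unfolding X_def by (rule disjoint_union[OF \<P>1(1) Q(1)])
      \<comment> \<open>Disjoint nonempty sets are different, so no chopped block is itself one of
        the tiles.\<close>
      have "B \<noteq> {}" if "B \<in> Q" for B using Q(2) that h by auto
      then have XQ: "X - Q = \<P>" unfolding X_def using apart by blast
      have cU: "card (\<Union>X) = card X * h" by (rule card_Union_blocks) (use finX disjX cardX h in auto)
      have cQ: "card (\<Union>Q) = card Q * h"
        by (rule card_Union_blocks) (use finX Q h in \<open>auto simp: X_def\<close>)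
      have UXV: "\<Union>X \<subseteq> V" using XV by blast
      have UQV: "\<Union>Q \<subseteq> ?U" using Q(2) by blast
      have rest: "V - \<Union>X = ?U - \<Union>Q" by (auto simp: X_def)
      have n: "card V = card X * h + card (V - \<Union>X)"
        using V UXV cU by (metis Nat.add_diff_assoc add_diff_cancel_left' card_Diff_subset card_mono finite_subset)
      have u: "card ?U = card Q * h + card (?U - \<Union>Q)"
        using V UQV cQ by (metis Nat.add_diff_assoc add_diff_cancel_left' card_Diff_subset card_mono finite_subset finite_Diff)
      have "(r0 + 1) * h < (card X + 1) * h"
      proof -
        have "(r0 + 1) * h \<le> card V" using big unfolding n0_def by linarith
        also have "\<dots> < card X * h + h" unfolding n using Q(3) rest by simp
        finally show ?thesis by simp
      qed
      then have r0: "r0 \<le> card X" using mult_less_cancel2 by simp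
      have "4 * real h / \<eta> \<le> ?n" using big unfolding n0_def by linarith
      then have hn: "4 * real h \<le> \<eta> * ?n" using \<eta> by (simp add: field_simps)
      have rn: "real (card X) * h \<le> ?n" unfolding n by simp
      \<comment> \<open>More than \<open>\<eta> * ?n\<close> vertices are uncovered and fewer than
        \<open>h\<close> of them escape the chopping, so the chopped blocks cover at least
        \<open>\<eta> * ?n / 2\<close> vertices.\<close>
      have Qbig: "\<epsilon> * card X \<le> card Q"
      proof -
        have "\<eta> * ?n < real (card Q) * h + h"
        proof -
          have "card ?U < card Q * h + h" unfolding u using Q(3) by simp
          then have "real (card ?U) < real (card Q * h + h)" by (simp only: of_nat_less_iff)
          then show ?thesis using U by simp
        qed
        moreover have "\<epsilon> * ?n = \<eta> * ?n / 2" by (simp add: \<epsilon>_def)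
        ultimately have "\<epsilon> * ?n \<le> real (card Q) * h" using hn by linarith
        moreover have "\<epsilon> * (real (card X) * h) \<le> \<epsilon> * ?n" using rn \<epsilon> by (intro mult_left_mono) auto
        ultimately have "(\<epsilon> * card X) * h \<le> real (card Q) * h" by simp
        then show ?thesis using h by simp
      qed
      have "\<forall>B\<in>X. \<exists>f. bij_betw f {..<h} B"
      proof
        fix B assume B: "B \<in> X"
        then have "finite B" using XV V by (auto intro: finite_subset)
        then show "\<exists>f. bij_betw f {..<h} B"
          using ex_bij_betw_nat_finite[of B] cardX[OF B] by (simp add: lessThan_atLeast0)
      qed
      from bchoice[OF this] obtain \<phi> where \<phi>: "\<forall>B\<in>X. bij_betw (\<phi> B) {..<h} B" by blast
      define \<Phi> where "\<Phi> p = \<phi> (fst p) (snd p)" for p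
      have \<Phi>: "bij_betw \<Phi> (X \<times> {..<h}) (\<Union>X)"
        unfolding \<Phi>_def by (rule bij_betw_blocks) (use disjX \<phi> in auto)
      let ?E = "\<lambda>u v. E (\<Phi> u) (\<Phi> v)"
      \<comment> \<open>The fewer than \<open>h\<close> vertices outside the blocks cost at most
        \<open>2 * h\<close> in degree, which is at most \<open>\<epsilon> * ?n\<close>.\<close>
      have degX: "(1 + \<epsilon>) * h * card X \<le> deg_in ?E (X \<times> {..<h}) v" if v: "v \<in> X \<times> {..<h}" for v
      proof -
        have "\<Phi> v \<in> \<Union>X" using \<Phi> v by (auto dest: bij_betwE)
        then have "\<Phi> v \<in> V" using UXV by blast
        then have "(1 + \<eta>) * ?n \<le> deg_in E V (\<Phi> v)" using deg by blast
        also have "\<dots> \<le> deg_in E (\<Union>X) (\<Phi> v) + 2 * real (card (V - \<Union>X))"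
          using deg_in_le_Diff[OF V UXV, of E "\<Phi> v"] by linarith
        also have "\<dots> \<le> deg_in E (\<Union>X) (\<Phi> v) + \<epsilon> * ?n"
        proof -
          have "real (card (V - \<Union>X)) \<le> h" using Q(3) rest by simp
          then show ?thesis using hn unfolding \<epsilon>_def by simp
        qed
        finally have "(1 + \<epsilon>) * ?n \<le> deg_in E (\<Union>X) (\<Phi> v)" by (simp add: \<epsilon>_def algebra_simps)
        moreover have "(1 + \<epsilon>) * (real (card X) * h) \<le> (1 + \<epsilon>) * ?n"
          using rn \<epsilon> by (intro mult_left_mono) auto
        ultimately show ?thesis unfolding deg_in_bij_betw[OF \<Phi>] by (simp add: algebra_simps)
      qed
      have "\<exists>C F J. (\<forall>i<s. C i \<subseteq> X \<and> card (C i) = h) \<and> disjoint_family_on C {..<s} \<and> J \<subseteq> {..<s} \<and>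
        (\<forall>i<s. \<forall>x\<in>C i. x \<in> Q \<longleftrightarrow> i \<in> J) \<and>
        (\<forall>i<s. \<forall>j<s. \<forall>x\<in>C i. \<forall>y\<in>C j. \<forall>a<h. \<forall>b<h. F (i, a) (j, b) \<longrightarrow> ?E (x, a) (y, b)) \<and>
        real (card (low_degree \<epsilon> s h F)) < \<epsilon> / 2 * h * card J"
        by (rule hb[THEN spec, THEN spec, THEN spec, THEN mp], intro conjI ballI degX)
          (use finX r0 Qbig in \<open>auto simp: X_def\<close>)
      then obtain C F J where C: "\<forall>i<s. C i \<subseteq> X \<and> card (C i) = h" "disjoint_family_on C {..<s}"
        and J: "J \<subseteq> {..<s}" "\<forall>i<s. \<forall>x\<in>C i. x \<in> Q \<longleftrightarrow> i \<in> J"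
        and hom: "\<forall>i<s. \<forall>j<s. \<forall>x\<in>C i. \<forall>y\<in>C j. \<forall>a<h. \<forall>b<h. F (i, a) (j, b) \<longrightarrow> ?E (x, a) (y, b)"
        and low: "real (card (low_degree \<epsilon> s h F)) < \<epsilon> / 2 * h * card J"
        by (elim exE conjE)
      have "\<exists>\<P>'. disjoint \<P>' \<and> (\<forall>T\<in>\<P>'. blowup_set k t E T \<and> T \<subseteq> \<Union>X) \<and> card (X - Q) < card \<P>'"
      proof (rule augment[OF h_def \<epsilon> h(1), where C = C and J = J and F = F and s = s and \<phi> = \<phi>])
        show "E (\<phi> x a) (\<phi> y b)" if "i < s" "j < s" "x \<in> C i" "y \<in> C j" "a < h" "b < h"
          "F (i, a) (j, b)" for i j x y a b
          using hom that unfolding \<Phi>_def by fastforce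
        show "blowup_set k t E B" if "B \<in> X - Q" for B using that \<P>1(2) XQ by blast
      qed (use finX disjX cardX C J \<phi> low in \<open>auto simp: X_def\<close>)
      then obtain \<P>' where \<P>': "disjoint \<P>'" "\<forall>T\<in>\<P>'. blowup_set k t E T \<and> T \<subseteq> \<Union>X" "card \<P> < card \<P>'"
        unfolding XQ by blast
      then have "\<P>' \<in> \<S>" using UXV unfolding \<S>_def by blast
      then show False using max \<P>'(3) by fastforce
    qed
    then show "\<exists>\<P>. disjoint \<P> \<and> (\<forall>T\<in>\<P>. blowup_set k t E T \<and> T \<subseteq> V) \<and> card (V - \<Union>\<P>) \<le> \<eta> * card V"
      using \<P>1 by blast
  qed
qed

section \<open>From vertex sets to copies in digraphs\<close>

text \<open>Bijections from \<open>{1..t i}\<close> to the parts combine to a map \<open>g\<close>.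
  The copy takes just the images of the arcs of \<open>path_blowup k t\<close>, because
  \<open>T\<close> may span more arcs in \<open>G\<close>.\<close>

lemma copy_of_blowup_set:
  assumes G: "pair_digraph G" and T: "T \<subseteq> pverts G"
    and blow: "blowup_set k t (\<lambda>u v. (u, v) \<in> parcs G) T"
  shows "\<exists>C. copy_of (path_blowup k t) G C \<and> pverts C = T"
proof -
  interpret G: pair_digraph G by (fact G)
  let ?H = "path_blowup k t"
  interpret H: pair_digraph ?H by (rule pair_digraph_path_blowup)
  obtain A where A: "T = (\<Union>i\<in>{1..k}. A i)" "\<forall>i\<in>{1..k}. finite (A i) \<and> card (A i) = t i"
      "disjoint_family_on A {1..k}" "\<forall>i\<in>{1..<k}. \<forall>x\<in>A i. \<forall>y\<in>A (Suc i). (x, y) \<in> parcs G"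
    using blow unfolding blowup_set_def by blast
  have "\<forall>i\<in>{1..k}. \<exists>f. bij_betw f {1..t i} (A i)"
    using A(2) ex_bij_betw_nat_finite_1 by metis
  from bchoice[OF this] obtain e where e: "\<forall>i\<in>{1..k}. bij_betw (e i) {1..t i} (A i)" by blast
  define g where "g p = e (fst p) (snd p)" for p
  have ge: "g (i, a) \<in> A i" if "i \<in> {1..k}" "a \<in> {1..t i}" for i a
  proof -
    have "bij_betw (e i) {1..t i} (A i)" using e that(1) by blast
    from bij_betw_apply[OF this that(2)] show ?thesis by (simp add: g_def)
  qed
  have inj: "inj_on g (pverts ?H)"
  proof (rule inj_onI)
    fix p q assume pq: "p \<in> pverts ?H" "q \<in> pverts ?H" "g p = g q"
    then have in1: "fst p \<in> {1..k}" "snd p \<in> {1..t (fst p)}" "fst q \<in> {1..k}" "snd q \<in> {1..t (fst q)}"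
      by (auto simp: path_blowup_def)
    then have "g p \<in> A (fst p)" "g q \<in> A (fst q)" using ge by (metis prod.collapse)+
    then have eq: "fst p = fst q" using A(3) in1 pq(3) unfolding disjoint_family_on_def by fastforce
    moreover have "inj_on (e (fst p)) {1..t (fst p)}" using e in1 by (auto simp: bij_betw_def)
    ultimately show "p = q" using pq(3) in1 unfolding g_def by (auto simp: prod_eq_iff dest: inj_onD)
  qed
  have img: "g ` pverts ?H = T"
  proof -
    have "g ` pverts ?H = (\<Union>i\<in>{1..k}. e i ` {1..t i})"
      by (force simp: path_blowup_def g_def)
    also have "\<dots> = T" unfolding A(1) using e by (auto simp: bij_betw_def)
    finally show ?thesis .
  qed
  define C where "C = \<lparr>pverts = T, parcs = map_prod g g ` parcs ?H\<rparr>"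
  have arcs: "map_prod g g ` parcs ?H \<subseteq> parcs G"
  proof
    fix x assume "x \<in> map_prod g g ` parcs ?H"
    then obtain i a b where i: "i \<in> {1..k - 1}" "a \<in> {1..t i}" "b \<in> {1..t (Suc i)}"
        "x = (g (i, a), g (Suc i, b))"
      by (auto simp: path_blowup_def)
    then have "g (i, a) \<in> A i" "g (Suc i, b) \<in> A (Suc i)" by (auto intro!: ge)
    moreover have "i \<in> {1..<k}" using i(1) by auto
    ultimately show "x \<in> parcs G" using A(4) i(4) by blast
  qed
  have "pair_wf_digraph C"
    by unfold_locales (use img H.in_arcsD1 H.in_arcsD2 in \<open>auto simp: C_def\<close>)
  then have wfC: "wf_digraph (with_proj C)" by (simp add: wf_digraph_wp_iff)
  have "subgraph (with_proj C) (with_proj G)"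
    unfolding subgraph_def using T arcs wfC G.wf_digraph_axioms
    by (simp add: C_def compatible_def)
  moreover have "digraph_iso (with_proj ?H) (with_proj C)"
    unfolding digraph_iso_def
  proof (intro exI conjI)
    let ?f = "\<lparr>iso_verts = g, iso_arcs = map_prod g g, iso_head = snd, iso_tail = fst\<rparr>"
    \<comment> \<open>Arcs are pairs of vertices, so injectivity on vertices carries over to
      arcs.\<close>
    have "inj_on (map_prod g g) (pverts ?H \<times> pverts ?H)" using inj by (intro map_prod_inj_on)
    then have "inj_on (map_prod g g) (parcs ?H)"
      by (rule inj_on_subset) (use H.in_arcsD1 H.in_arcsD2 in auto)
    then show "pre_digraph.digraph_isomorphism (with_proj ?H) ?f"
      unfolding pre_digraph.digraph_isomorphism_def using inj H.wf_digraph_axioms by simp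
    show "with_proj C = app_iso ?f (with_proj ?H)"
      unfolding app_iso_def by (simp add: with_proj_def C_def img)
  qed
  ultimately show ?thesis unfolding copy_of_def by (intro exI[of _ C]) (simp add: C_def)
qed

lemma degree_eq_deg_in:
  assumes "pair_digraph G"
  shows "in_degree (with_proj G) v + out_degree (with_proj G) v
    = deg_in (\<lambda>u w. (u, w) \<in> parcs G) (pverts G) v"
proof -
  interpret pair_digraph G by (fact assms)
  have "in_arcs (with_proj G) v = (\<lambda>u. (u, v)) ` {u \<in> pverts G. (u, v) \<in> parcs G}"
    using in_arcsD1 by (auto simp: in_arcs_def)
  moreover have "out_arcs (with_proj G) v = (\<lambda>u. (v, u)) ` {u \<in> pverts G. (v, u) \<in> parcs G}"
    using in_arcsD2 by (auto simp: out_arcs_def)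
  ultimately show ?thesis
    unfolding in_degree_def out_degree_def deg_in_def by (simp add: card_image inj_on_def)
qed

theorem theorem3p1:
  fixes k :: nat and t :: "nat \<Rightarrow> nat"
  assumes "k \<ge> 2"
    and "\<forall>i\<in>{1..k}. t i \<ge> 1"
  shows "\<forall>\<eta>::real. \<eta> > 0 \<longrightarrow>
    (\<exists>n0::nat. \<forall>n\<ge>n0. \<forall>G::'a pair_pre_digraph.
      pair_digraph G \<and> card (pverts G) = n \<and> real (min_total_degree G) \<ge> (1 + \<eta>) * real n \<longrightarrow>
      (\<exists>\<T>. tiling (path_blowup k t) G \<T> \<and>
           real (card (pverts G - (\<Union>C\<in>\<T>. pverts C))) \<le> \<eta> * real n))"
proof (intro allI impI)
  fix \<eta> :: real assume \<eta>: "\<eta> > 0"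
  have "t 1 \<le> sum t {1..k}" using assms(1) by (intro member_le_sum) auto
  moreover have "t 1 \<ge> 1" using assms by auto
  ultimately have pos: "sum t {1..k} > 0" by linarith
  \<comment> \<open>The tiling result needs a parameter of at most 1; passing to a smaller one
    weakens the degree condition and strengthens the conclusion.\<close>
  let ?\<mu> = "min \<eta> 1"
  have \<mu>: "0 < ?\<mu>" "?\<mu> \<le> 1" using \<eta> by auto
  from almost_perfect_blowup_tiling[OF \<mu> pos] obtain n0 where
    n0: "\<forall>(V::'a set) E. finite V \<and> n0 \<le> card V \<and>
      (\<forall>v\<in>V. (1 + ?\<mu>) * card V \<le> deg_in E V v) \<longrightarrow>
      (\<exists>\<P>. disjoint \<P> \<and> (\<forall>T\<in>\<P>. blowup_set k t E T \<and> T \<subseteq> V) \<and> card (V - \<Union>\<P>) \<le> ?\<mu> * card V)"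
    by (elim exE)
  show "\<exists>n0::nat. \<forall>n\<ge>n0. \<forall>G::'a pair_pre_digraph.
      pair_digraph G \<and> card (pverts G) = n \<and> real (min_total_degree G) \<ge> (1 + \<eta>) * real n \<longrightarrow>
      (\<exists>\<T>. tiling (path_blowup k t) G \<T> \<and>
           real (card (pverts G - (\<Union>C\<in>\<T>. pverts C))) \<le> \<eta> * real n)"
  proof (rule exI[of _ n0], intro allI impI, elim conjE)
    fix n and G :: "'a pair_pre_digraph"
    assume n: "n0 \<le> n" and G: "pair_digraph G" and card: "card (pverts G) = n"
      and deg: "real (min_total_degree G) \<ge> (1 + \<eta>) * real n"
    let ?V = "pverts G" and ?E = "\<lambda>u v. (u, v) \<in> parcs G"
    have fin: "finite ?V"
      using G by (simp add: pair_digraph_def pair_fin_digraph_def pair_fin_digraph_axioms_def)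
    have degV: "(1 + ?\<mu>) * card ?V \<le> deg_in ?E ?V v" if v: "v \<in> ?V" for v
    proof -
      \<comment> \<open>The minimum is over a nonempty set, as \<open>v\<close> is a vertex, so its
        unspecified value for the empty digraph does not enter.\<close>
      have "real (min_total_degree G) \<le> real (deg_in ?E ?V v)"
        unfolding of_nat_le_iff min_total_degree_def degree_eq_deg_in[OF G] using fin v by (intro Min_le) auto
      moreover have "(1 + ?\<mu>) * card ?V \<le> (1 + \<eta>) * card ?V" by (intro mult_right_mono) auto
      ultimately show ?thesis using deg unfolding card by linarith
    qed
    have "\<exists>\<P>. disjoint \<P> \<and> (\<forall>T\<in>\<P>. blowup_set k t ?E T \<and> T \<subseteq> ?V)
        \<and> card (?V - \<Union>\<P>) \<le> ?\<mu> * card ?V"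
      by (rule n0[THEN spec, THEN spec, THEN mp], intro conjI ballI degV) (use fin n card in auto)
    then obtain \<P> where \<P>: "disjoint \<P>" "\<forall>T\<in>\<P>. blowup_set k t ?E T \<and> T \<subseteq> ?V"
        "card (?V - \<Union>\<P>) \<le> ?\<mu> * card ?V" by (elim exE conjE)
    have "\<forall>T\<in>\<P>. \<exists>C. copy_of (path_blowup k t) G C \<and> pverts C = T"
      using \<P>(2) copy_of_blowup_set[OF G] by blast
    from bchoice[OF this] obtain c where
      c: "\<forall>T\<in>\<P>. copy_of (path_blowup k t) G (c T) \<and> pverts (c T) = T" by blast
    have "tiling (path_blowup k t) G (c ` \<P>)"
      unfolding tiling_def
    proof (intro conjI ballI impI)
      fix C D assume "C \<in> c ` \<P>" "D \<in> c ` \<P>" "C \<noteq> D"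
      then obtain S T where "S \<in> \<P>" "T \<in> \<P>" "C = c S" "D = c T" "S \<noteq> T" by auto
      then show "pverts C \<inter> pverts D = {}" using c disjointD[OF \<P>(1)] by simp
    qed (use c in auto)
    moreover have "(\<Union>C\<in>c ` \<P>. pverts C) = \<Union>\<P>" using c by auto
    moreover have "?\<mu> * card ?V \<le> \<eta> * n" unfolding card by (intro mult_right_mono) auto
    ultimately show "\<exists>\<T>. tiling (path_blowup k t) G \<T> \<and>
           real (card (pverts G - (\<Union>C\<in>\<T>. pverts C))) \<le> \<eta> * real n"
      using \<P>(3) by (intro exI[of _ "c ` \<P>"]) auto
  qed
qed

end
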